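(* Let $(\mu_\varepsilon)_{0\le\varepsilon\le1}$ be a family of probability distributions on $\mathbb{R}$ with CGFs $K_\varepsilon$, and let $x\in\mathbb{R}$. Assume: (A1) for each $\varepsilon\in[0,1]$, $\mathcal{D}_\varepsilon$ contains an open interval that includes $0$; (A2) for each $\varepsilon\in[0,1]$, the support of $\mu_\varepsilon$ is all of $\mathbb{R}$ and the characteristic function of $\mu_\varepsilon$ is (Lebesgue) integrable on $\mathbb{R}$ (so $\mu_\varepsilon$ has a continuous density $f_\varepsilon$); (A3) there is $\delta_0>0$ such that $K''_\varepsilon(\theta)\ge\delta_0$ for all $\theta\in\mathcal{O}_\varepsilon$ and $\varepsilon\in[0,1]$; (A4) for each $\varepsilon\in(0,1]$ there is an interval $\mathcal{I}_\varepsilon\subset\mathcal{D}_\varepsilon$ such that $\mathcal{I}_\varepsilon\subset\mathcal{I}_{\varepsilon'}$ whenever $\varepsilon\ge\varepsilon'$, and $\bigcup_\varepsilon\mathcal{I}_\varepsilon=\mathbb{R}$; (A5) for each integer $r\ge0$, $K^{(r)}_\varepsilon\to K^{(r)}_0$ uniformly on every compact subset of $\mathbb{R}$ as $\varepsilon\to0$; moreover, for each integer $r\ge3$ and each compact $C\subset\mathbb{R}$, $\limsup_{\varepsilon\to0}\sup_{\theta\in C}\varepsilon^{-(r-2)}|K^{(r)}_\varepsilon(\theta)|<\infty$. Assume moreover that for all sufficiently small $\varepsilon>0$ the exact expansion $f_\varepsilon(x)=\sum_{m=0}^\infty\Theta_m$ holds, where $$\Theta_m=\Theta_m^\varepsilon=\phi(\hat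 w_\varepsilon)\frac{(-1)^m\,\hat\theta^{(2m+1)}_\varepsilon}{(2m)!!}.$$ Then $\Theta_m=O(\varepsilon^{2m})$ as $\varepsilon\to0$ for each integer $m\ge0$. If, in addition, (A8) there exist $\varepsilon_2\in(0,1]$ and positive constants $C_n$ ($n\ge1$) such that $|\hat\theta^{(n)}_\varepsilon|\le C_n\varepsilon^{n-1}$ for all $n\ge1$ and $0<\varepsilon\le\varepsilon_2$, and $\sum_{n=1}^\infty\frac{C_n}{n!!}\varepsilon_2^n<\infty$, then for each integer $M\ge0$ $$f_\varepsilon(x)=\sum_{m=0}^M\Theta_m+O(\varepsilon^{2(M+1)})\qquad\text{as }\varepsilon\to0.$$
   Context: $K_\varepsilon(\theta)=\log\int_{\mathbb{R}}e^{\theta y}\mu_\varepsilon(dy)$; $\mathcal{D}_\varepsilon=\{\theta\in\mathbb{R}:|K_\varepsilon(\theta)|<\infty\}$; $\mathcal{O}_\varepsilon$ is the interior of $\mathcal{D}_\varepsilon$. It is a standing convention that $K'_\varepsilon$ maps $\mathcal{O}_\varepsilon$ onto $\mathbb{R}$; the saddlepoint $\hat\theta_\varepsilon\in\mathcal{O}_\varepsilon$ is the unique solution of $K'_\varepsilon(\hat\theta_\varepsilon)=x$. (By (A4), every compact set lies in $\mathcal{D}_\varepsilon$ for small $\varepsilon$, so (A5) makes sense.) Set $\mathrm{sgn}(a)=1$ for $a\ge0$, $-1$ for $a<0$, and $\hat w_\varepsilon=\mathrm{sgn}(\hat\theta_\varepsilon)\sqrt{2(x\hat\theta_\varepsilon-K_\varepsilon(\hat\theta_\varepsilon))}$.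 For $\theta\in\mathcal{O}_\varepsilon$ put $$w_\varepsilon(\theta)=\hat w_\varepsilon+\mathrm{sgn}(\theta-\hat\theta_\varepsilon)\sqrt{2\{(K_\varepsilon(\theta)-x\theta)-(K_\varepsilon(\hat\theta_\varepsilon)-x\hat\theta_\varepsilon)\}},$$ a strictly increasing real-analytic function with nonvanishing derivative; let $\theta_\varepsilon(w)$ be its analytic inverse function, and $\hat\theta^{(n)}_\varepsilon=\frac{d^n\theta_\varepsilon}{dw^n}(\hat w_\varepsilon)$. Here $n!!$ is the double factorial ($0!!=1$) and $\phi(y)=\frac1{\sqrt{2\pi}}e^{-y^2/2}$. $a_\varepsilon=O(\varepsilon^r)$ as $\varepsilon\to0$ means $\limsup_{\varepsilon\downarrow0}\varepsilon^{-r}|a_\varepsilon|<\infty$. *)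

theory Defs
  imports "HOL-Probability.Probability" "HOL-Library.Landau_Symbols"
begin

definition cgf :: "real measure \<Rightarrow> real \<Rightarrow> real" where
  "cgf \<mu> \<theta> = ln (\<integral>y. exp (\<theta> * y) \<partial>\<mu>)"

(* The integrand is positive, so for a probability measure the extended-real valued logarithm of
   the integral is finite iff the integrand is integrable. Outside this set the real-valued
   function cgf carries the junk value ln 0. *)
definition cgf_domain :: "real measure \<Rightarrow> real set" where
  "cgf_domain \<mu> = {\<theta>. integrable \<mu> (\<lambda>y. exp (\<theta> * y))}"

definition measure_support :: "real measure \<Rightarrow> real set" where
  "measure_support \<mu> = {y. \<forall>U. open U \<longrightarrow> y \<in> U \<longrightarrow> emeasure \<mu> U > 0}"

(* For a probability measure with integrable characteristic function such a density exists by
   Fourier inversion; it is unique because two continuous functions that agree almost everywhere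
   are equal. *)
definition continuous_density :: "real measure \<Rightarrow> real \<Rightarrow> real" where
  "continuous_density \<mu> =
     (THE f. continuous_on UNIV f \<and> (\<forall>y. 0 \<le> f y) \<and> \<mu> = density lborel (\<lambda>y. ennreal (f y)))"

definition saddlepoint :: "real measure \<Rightarrow> real \<Rightarrow> real" where
  "saddlepoint \<mu> x = (THE \<theta>. \<theta> \<in> interior (cgf_domain \<mu>) \<and> deriv (cgf \<mu>) \<theta> = x)"

(* Unlike the library's sgn, this takes the value 1 at 0. *)
definition sgn_pm :: "real \<Rightarrow> real" where
  "sgn_pm a = (if a \<ge> 0 then 1 else -1)"

definition w_hat :: "real measure \<Rightarrow> real \<Rightarrow> real" where
  "w_hat \<mu> x = (let \<theta>h = saddlepoint \<mu> x
                in sgn_pm \<theta>h * sqrt (2 * (x * \<theta>h - cgf \<mu> \<theta>h)))"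

definition w_fun :: "real measure \<Rightarrow> real \<Rightarrow> real \<Rightarrow> real" where
  "w_fun \<mu> x \<theta> = (let \<theta>h = saddlepoint \<mu> x
                   in w_hat \<mu> x + sgn_pm (\<theta> - \<theta>h) *
                        sqrt (2 * ((cgf \<mu> \<theta> - x * \<theta>) - (cgf \<mu> \<theta>h - x * \<theta>h))))"

definition theta_fun :: "real measure \<Rightarrow> real \<Rightarrow> real \<Rightarrow> real" where
  "theta_fun \<mu> x = inv_into (interior (cgf_domain \<mu>)) (w_fun \<mu> x)"

definition theta_hat_deriv :: "nat \<Rightarrow> real measure \<Rightarrow> real \<Rightarrow> real" where
  "theta_hat_deriv n \<mu> x = (deriv ^^ n) (theta_fun \<mu> x) (w_hat \<mu> x)"

fun double_fact :: "nat \<Rightarrow> nat" where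
  "double_fact 0 = 1"
| "double_fact (Suc 0) = 1"
| "double_fact (Suc (Suc n)) = Suc (Suc n) * double_fact n"

definition Theta_term :: "nat \<Rightarrow> real measure \<Rightarrow> real \<Rightarrow> real" where
  "Theta_term m \<mu> x =
     std_normal_density (w_hat \<mu> x) *
       ((-1) ^ m * theta_hat_deriv (2 * m + 1) \<mu> x / real (double_fact (2 * m)))"

end

(* By definition of w, the excess of K(theta) - x theta over its minimum, written as a power series
   A in theta - theta_hat, satisfies A(T(v)) = v^2/2, where T is the power series of theta(w) -
   theta_hat in v = w - w_hat. Comparing coefficients gives 2 A_2 T_1^2 = 1 and, after multiplying the
   identity for the coefficient of v^(m+1) by T_1, a division-free recursion for T_m. If A_r has size
   epsilon^(r-2) and A_2 is bounded below, every term of this recursion has size epsilon^(m-1), so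
   induction yields T_m = O(epsilon^(m-1)).
   Strong convexity (A3) bounds theta_hat, so (A5) applies on one compact interval. For r = 2 the bound
   on K^(2) at theta_hat comes from K^(2)(0) and the bound on K^(3) by the mean value theorem.
   For the remainder, the tail of the series is dominated by the one in (A8) at epsilon_2 / 2: the
   factor 4^(-m) gained by halving compensates for (2m+1)!!/(2m)!! <= 4^m. *)
theory Submission
  imports Defs "HOL-Complex_Analysis.Complex_Analysis"
begin

section \<open>Real-analytic functions through complex power series\<close>

text \<open>Real analyticity at \<open>c\<close>, witnessed by a complex function so that the holomorphic inverse
  function theorem and the composition of complex power series are available.\<close>
definition has_complex_expansion :: "(real \<Rightarrow> real) \<Rightarrow> real \<Rightarrow> complex fps \<Rightarrow> bool" where
  "has_complex_expansion f c A \<longleftrightarrow>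
     (\<exists>F. F has_fps_expansion A \<and> (\<forall>\<^sub>F t in nhds 0. F (of_real t) = of_real (f (c + t))))"

lemma eventually_nhds_of_real:
  assumes "\<forall>\<^sub>F z in nhds (0::complex). P z"
  shows "\<forall>\<^sub>F t in nhds (0::real). P (of_real t)"
proof -
  have "filterlim complex_of_real (nhds (of_real 0)) (nhds 0)"
    by (intro tendsto_of_real filterlim_ident)
  then show ?thesis using assms by (simp add: filterlim_iff)
qed

text \<open>Restricted to the real axis, \<open>F\<close> has real part \<open>f\<close>, with
  derivative the real part of \<open>deriv F\<close>, and imaginary part constantly 0, so the
  imaginary part of \<open>deriv F\<close> vanishes there. Hence \<open>deriv F\<close> is a complex
  witness for \<open>deriv f\<close>. Both conclusions come out of the same computation.\<close>

lemma has_complex_expansion_deriv_aux: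
  assumes "has_complex_expansion f c A"
  shows "has_complex_expansion (deriv f) c (fps_deriv A) \<and> (f has_field_derivative deriv f c) (at c)"
proof -
  obtain F where F: "F has_fps_expansion A"
    and ev: "\<forall>\<^sub>F t in nhds 0. F (of_real t) = of_real (f (c + t))"
    using assms by (auto simp: has_complex_expansion_def)
  obtain s where s: "open s" "0 \<in> s" "F holomorphic_on s"
    using has_fps_expansion_imp_holomorphic[OF F] by metis
  have "\<forall>\<^sub>F t in nhds 0. complex_of_real t \<in> s"
    using s by (intro eventually_nhds_of_real eventually_nhds_in_open)
  with ev have "\<forall>\<^sub>F t in nhds 0. complex_of_real t \<in> s \<and> F (of_real t) = of_real (f (c + t))"
    by eventually_elim auto
  then obtain u where u: "open u" "(0::real) \<in> u"
     "\<And>t. t \<in> u \<Longrightarrow> complex_of_real t \<in> s"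
     "\<And>t. t \<in> u \<Longrightarrow> F (of_real t) = of_real (f (c + t))"
    unfolding eventually_nhds by metis
  have der: "(f has_field_derivative Re (deriv F (of_real t))) (at (c + t)) \<and>
             Im (deriv F (of_real t)) = 0" if t: "t \<in> u" for t
  proof -
    have "(F has_field_derivative deriv F (of_real t)) (at (of_real t))"
      using s u(3)[OF t] by (intro holomorphic_derivI)
    then have v: "((\<lambda>t. F (of_real t)) has_vector_derivative deriv F (of_real t)) (at t)"
      by (rule has_vector_derivative_real_field)
    have near: "\<forall>\<^sub>F x in nhds t. x \<in> u"
      using u(1) t by (rule eventually_nhds_in_open)
    have "((\<lambda>t. Re (F (of_real t))) has_vector_derivative Re (deriv F (of_real t))) (at t)"
      by (rule bounded_linear.has_vector_derivative[OF bounded_linear_Re v])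
    then have "((\<lambda>t. Re (F (of_real t))) has_field_derivative Re (deriv F (of_real t))) (at t)"
      by (simp add: has_real_derivative_iff_has_vector_derivative)
    moreover have *: "\<forall>\<^sub>F x in nhds t. Re (F (of_real x)) = f (c + x)"
      using near by eventually_elim (simp add: u(4))
    ultimately have "((\<lambda>x. f (c + x)) has_field_derivative Re (deriv F (of_real t))) (at t)"
      using DERIV_cong_ev[OF refl * refl] by blast
    then have a: "(f has_field_derivative Re (deriv F (of_real t))) (at (c + t))"
      by (simp add: DERIV_shift add.commute[of c])
    have "((\<lambda>t. Im (F (of_real t))) has_vector_derivative Im (deriv F (of_real t))) (at t)"
      by (rule bounded_linear.has_vector_derivative[OF bounded_linear_Im v])
    then have "((\<lambda>t. Im (F (of_real t))) has_field_derivative Im (deriv F (of_real t))) (at t)"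
      by (simp add: has_real_derivative_iff_has_vector_derivative)
    moreover have *: "\<forall>\<^sub>F x in nhds t. Im (F (of_real x)) = 0"
      using near by eventually_elim (simp add: u(4))
    ultimately have "((\<lambda>x. 0) has_field_derivative Im (deriv F (of_real t))) (at t)"
      using DERIV_cong_ev[OF refl * refl] by blast
    then have "Im (deriv F (of_real t)) = 0"
      using DERIV_unique DERIV_const by blast
    with a show ?thesis by simp
  qed
  have "deriv F (of_real t) = of_real (deriv f (c + t))" if "t \<in> u" for t
    using der[OF that] DERIV_imp_deriv by (metis complex_eq_iff Re_complex_of_real Im_complex_of_real)
  moreover have "\<forall>\<^sub>F t in nhds 0. t \<in> u"
    using u by (intro eventually_nhds_in_open)
  ultimately have "\<forall>\<^sub>F t in nhds 0. deriv F (of_real t) = of_real (deriv f (c + t))"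
    by (auto elim: eventually_mono)
  moreover have "deriv F has_fps_expansion fps_deriv A"
    using F by (rule has_fps_expansion_deriv)
  moreover have "(f has_field_derivative deriv f c) (at c)"
    using der[OF u(2)] DERIV_imp_deriv by fastforce
  ultimately show ?thesis
    by (auto simp: has_complex_expansion_def)
qed

lemma has_complex_expansion_deriv:
  "has_complex_expansion f c A \<Longrightarrow> has_complex_expansion (deriv f) c (fps_deriv A)"
  using has_complex_expansion_deriv_aux by blast

lemma has_complex_expansion_DERIV:
  "has_complex_expansion f c A \<Longrightarrow> (f has_field_derivative deriv f c) (at c)"
  using has_complex_expansion_deriv_aux by blast

lemma has_complex_expansion_higher_deriv:
  "has_complex_expansion f c A \<Longrightarrow> \<exists>B. has_complex_expansion ((deriv ^^ n) f) c B"
  by (induction n) (auto intro: has_complex_expansion_deriv)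

text \<open>Induction through termwise differentiation. This ties the algebra of complex
  coefficients to the iterated real derivatives in which cumulants and
  \<open>theta_hat_deriv\<close> are expressed; in particular the expansion is determined by
  \<open>f\<close> and \<open>c\<close>.\<close>

lemma has_complex_expansion_nth:
  assumes "has_complex_expansion f c A"
  shows "fps_nth A n = of_real ((deriv ^^ n) f c) / fact n"
  using assms
proof (induction n arbitrary: f A)
  case 0
  then obtain F where F: "F has_fps_expansion A"
    and ev: "\<forall>\<^sub>F t in nhds 0. F (of_real t) = of_real (f (c + t))"
    by (auto simp: has_complex_expansion_def)
  have "F 0 = fps_nth A 0"
    using F by (rule has_fps_expansion_imp_0_eq_fps_nth_0)
  moreover have "F 0 = of_real (f c)"
    using eventually_nhds_x_imp_x[OF ev] by simp
  ultimately show ?case by simp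
next
  case (Suc n)
  have "fps_nth (fps_deriv A) n = of_real ((deriv ^^ n) (deriv f) c) / fact n"
    by (intro Suc.IH has_complex_expansion_deriv Suc.prems)
  then have "of_nat (Suc n) * fps_nth A (Suc n) = of_real ((deriv ^^ Suc n) f c) / fact n"
    by (simp add: funpow_swap1)
  then show ?case
    by (simp add: field_simps del: funpow.simps of_nat_Suc)
qed

text \<open>A positive value at \<open>c\<close> keeps \<open>F 0\<close> off the branch cut of
  \<open>Ln\<close>, and by continuity \<open>f\<close> stays positive nearby, where
  \<open>Ln\<close> and the real \<open>ln\<close> agree.\<close>

lemma has_complex_expansion_ln:
  assumes "has_complex_expansion f c A" "f c > 0"
  shows "\<exists>B. has_complex_expansion (\<lambda>t. ln (f t)) c B"
proof -
  obtain F where F: "F has_fps_expansion A"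
    and ev: "\<forall>\<^sub>F t in nhds 0. F (of_real t) = of_real (f (c + t))"
    using assms by (auto simp: has_complex_expansion_def)
  have F0: "F 0 = of_real (f c)"
    using eventually_nhds_x_imp_x[OF ev] by simp
  have "F analytic_on {0}" using F by (rule has_fps_expansion_imp_analytic_0)
  then have "(\<lambda>z. Ln (F z)) analytic_on {0}"
    by (intro analytic_intros) (use assms(2) F0 in auto)
  then have "(\<lambda>z. Ln (F z)) has_fps_expansion fps_expansion (\<lambda>z. Ln (F z)) 0"
    by (rule analytic_at_imp_has_fps_expansion_0)
  moreover have "isCont f c"
    using has_complex_expansion_DERIV[OF assms(1)] by (rule DERIV_isCont)
  then have f: "filterlim f (nhds (f c)) (nhds (c + 0))"
    by (simp add: isCont_def tendsto_at_iff_tendsto_nhds)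
  have "((\<lambda>t. f (c + t)) \<longlongrightarrow> f c) (nhds 0)"
    by (rule filterlim_compose[OF f]) (intro tendsto_add tendsto_const filterlim_ident)
  then have "\<forall>\<^sub>F t in nhds 0. f (c + t) > 0"
    by (rule order_tendstoD) fact
  with ev have "\<forall>\<^sub>F t in nhds 0. Ln (F (of_real t)) = of_real (ln (f (c + t)))"
    by eventually_elim (simp add: Ln_of_real)
  ultimately show ?thesis
    by (auto simp: has_complex_expansion_def)
qed

text \<open>The signed square root is the restriction to the real axis of a holomorphic
  \<open>V\<close> with \<open>V z ^ 2 / 2 = F z\<close> and nonzero derivative at 0. Its local
  inverse \<open>T\<close> satisfies F(T(v)) = v^2/2, and shifted by \<open>c\<close> it extends
  \<theta>. This yields both the analyticity of \<theta> and the identity from which its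
  coefficients are computed.\<close>

lemma has_complex_expansion_signed_sqrt_inverse:
  fixes f \<theta> :: "real \<Rightarrow> real"
  assumes f: "has_complex_expansion f c A"
    and zero: "f c = 0" "deriv f c = 0" and pos: "(deriv ^^ 2) f c > 0"
    and inv: "\<forall>\<^sub>F t in nhds 0. \<theta> (w + sgn_pm t * sqrt (2 * f (c + t))) = c + t"
  shows "\<exists>T. has_complex_expansion \<theta> w T \<and> A oo (T - fps_const (of_real c)) = fps_const (1/2) * fps_X ^ 2"
proof -
  obtain F where F: "F has_fps_expansion A"
    and ev: "\<forall>\<^sub>F t in nhds 0. F (of_real t) = of_real (f (c + t))"
    using f by (auto simp: has_complex_expansion_def)
  have A_nth: "fps_nth A 0 = 0" "fps_nth A 1 = 0"
    "2 * fps_nth A 2 = of_real ((deriv ^^ 2) f c)"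
    using zero has_complex_expansion_nth[OF f, of 0] has_complex_expansion_nth[OF f, of 1]
      has_complex_expansion_nth[OF f, of 2] by (auto simp: mult.commute)
  \<comment> \<open>Keeps \<open>2 * P 0\<close> off the branch cut of \<open>csqrt\<close>, so that
    \<open>Q\<close> below is analytic at 0 and nonzero there.\<close>
  have A2: "2 * fps_nth A 2 \<notin> \<real>\<^sub>\<le>\<^sub>0" using pos unfolding A_nth(3) by simp
  have "A \<noteq> 0" using pos A_nth(3) by auto
  then have "2 \<le> subdegree A"
    using A_nth by (intro subdegree_geI) (auto simp: less_2_cases_iff)
  \<comment> \<open>The double zero of \<open>F\<close> is factored out because \<open>csqrt\<close> is not holomorphic at 0.\<close>
  define P where "P = (\<lambda>z. if z = 0 then fps_nth A 2 else F z / z ^ 2)"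
  have "P has_fps_expansion fps_shift 2 A"
    unfolding P_def using F \<open>2 \<le> subdegree A\<close> by (intro has_fps_expansion_shift) auto
  then have P: "P analytic_on {0}" by (rule has_fps_expansion_imp_analytic_0)
  have P0: "P 0 = fps_nth A 2" by (simp add: P_def)
  have F0: "F 0 = 0" using has_fps_expansion_imp_0_eq_fps_nth_0[OF F] A_nth by simp
  have FP: "F z = z ^ 2 * P z" for z using F0 by (simp add: P_def)
  define Q where "Q = (\<lambda>z. csqrt (2 * P z))"
  define V where "V = (\<lambda>z. z * Q z)"
  have Q: "Q analytic_on {0}"
  proof -
    have "csqrt \<circ> (\<lambda>z. 2 * P z) analytic_on {0}"
      by (rule analytic_on_compose_gen[OF _ analytic_on_csqrt])
        (use A2 P0 in \<open>auto intro!: analytic_intros P\<close>)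
    then show ?thesis by (simp add: Q_def o_def)
  qed
  have "Q 0 \<noteq> 0" using A2 P0 by (auto simp: Q_def)
  have VF: "V z ^ 2 / 2 = F z" for z
    by (simp add: V_def Q_def FP power_mult_distrib)
  have V: "V analytic_on {0}"
    unfolding V_def by (intro analytic_intros Q)
  have "(V has_field_derivative Q 0) (at 0)"
  proof -
    have "(Q has_field_derivative deriv Q 0) (at 0)"
      using Q by (simp add: analytic_on_imp_differentiable_at DERIV_deriv_iff_field_differentiable)
    from DERIV_mult[OF DERIV_ident this] show ?thesis by (simp add: V_def)
  qed
  then have dV: "deriv V 0 \<noteq> 0" using \<open>Q 0 \<noteq> 0\<close> DERIV_imp_deriv by metis
  obtain S where S: "open S" "0 \<in> S" "V holomorphic_on S"
    using V by (auto simp: analytic_at)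
  obtain r where r: "r > 0" "ball 0 r \<subseteq> S" "open (V ` ball 0 r)" "inj_on V (ball 0 r)"
    using has_complex_derivative_locally_invertible[OF S(3,2,1) dV] by metis
  have holV: "V holomorphic_on ball 0 r" using S(3) r(2) by (rule holomorphic_on_subset)
  obtain T where T: "T holomorphic_on V ` ball 0 r" "\<And>z. z \<in> ball 0 r \<Longrightarrow> T (V z) = z"
    using holomorphic_has_inverse[OF holV open_ball r(4)] by metis
  have V0: "V 0 = 0" by (simp add: V_def)
  then have mem0: "0 \<in> V ` ball 0 r" using r(1) by force
  have T0: "T 0 = 0" using T(2)[of 0] V0 r(1) by simp
  have evV: "\<forall>\<^sub>F v in nhds 0. v \<in> V ` ball 0 r"
    using r(3) mem0 by (rule eventually_nhds_in_open)
  define B where "B = fps_expansion T 0"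
  have "T analytic_on {0}"
    using T(1) r(3) mem0 by (auto simp: analytic_at)
  then have B: "T has_fps_expansion B"
    unfolding B_def by (rule analytic_at_imp_has_fps_expansion_0)
  have B0: "fps_nth B 0 = 0" using has_fps_expansion_imp_0_eq_fps_nth_0[OF B] T0 by simp
  have eq: "A oo B = fps_const (1/2) * fps_X ^ 2"
  \<comment> \<open>Near 0 the function \<open>F \<circ> T\<close> is v^2/2; uniqueness of
    expansions turns this into an identity of formal power series.\<close>
  proof (rule fps_expansion_unique_complex)
    show "(F \<circ> T) has_fps_expansion (A oo B)"
      by (rule has_fps_expansion_compose[OF F B B0])
    have sq: "(\<lambda>v::complex. 1/2 * v ^ 2) has_fps_expansion fps_const (1/2) * fps_X ^ 2"
      by (intro fps_expansion_intros)
    have *: "\<forall>\<^sub>F v in nhds 0. 1/2 * v ^ 2 = (F \<circ> T) v"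
      using evV by eventually_elim (auto simp: T(2) VF[symmetric])
    then show "(F \<circ> T) has_fps_expansion fps_const (1/2) * fps_X ^ 2"
      using sq has_fps_expansion_cong[OF * refl] by blast
  qed
  define vr where "vr = (\<lambda>t. sgn_pm t * sqrt (2 * f (c + t)))"
  have ReP: "\<forall>\<^sub>F t in nhds 0. Re (P (of_real t)) > 0"
  proof -
    have "isCont P 0"
      using P by (simp add: analytic_on_imp_differentiable_at field_differentiable_imp_continuous_at)
    then have "filterlim P (nhds (P 0)) (nhds 0)"
      by (simp add: isCont_def tendsto_at_iff_tendsto_nhds)
    then have "((\<lambda>z. Re (P z)) \<longlongrightarrow> Re (P 0)) (nhds 0)"
      by (rule tendsto_Re)
    moreover have "Re (P 0) > 0"
    proof -
      have "2 * Re (P 0) = (deriv ^^ 2) f c"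
        using A_nth(3) P0 by (metis Re_complex_of_real Re_divide_numeral mult_2 plus_complex.sel(1))
      then show ?thesis using pos by simp
    qed
    ultimately show ?thesis
      by (intro eventually_nhds_of_real order_tendstoD)
  qed
  \<comment> \<open>For real \<open>t\<close> the value of \<open>P\<close> is a positive real
    \<open>q\<close>, so the principal root is the real one, and the absolute value produced by the
    root of t^2 is undone by \<open>sgn_pm t\<close>. The sign is recorded for the intermediate
    value argument below.\<close>
  have V_real: "\<forall>\<^sub>F t in nhds 0. V (of_real t) = of_real (vr t) \<and> (t \<noteq> 0 \<longrightarrow> sgn (vr t) = sgn t)"
    using ev ReP
  proof eventually_elim
    case (elim t)
    show ?case
    proof (cases "t = 0")
      case True
      then show ?thesis using V0 zero by (simp add: vr_def)
    next
      case False
      define q where "q = f (c + t) / t\<^sup>2"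
      have Pq: "P (of_real t) = of_real q" using False elim(1) by (simp add: P_def q_def)
      then have q: "q > 0" using elim(2) by simp
      have "f (c + t) = q * t\<^sup>2" using False by (simp add: q_def)
      then have "vr t = sgn_pm t * (sqrt (2 * q) * \<bar>t\<bar>)"
        by (simp add: vr_def real_sqrt_mult)
      also have "\<dots> = t * sqrt (2 * q)" by (auto simp: sgn_pm_def)
      finally have vr: "vr t = t * sqrt (2 * q)" .
      have "csqrt (2 * of_real q) = of_real (sqrt (2 * q))"
        using q of_real_sqrt[of "2 * q"] by simp
      then have "V (of_real t) = of_real (vr t)"
        by (simp add: V_def Q_def Pq vr)
      moreover have "sgn (vr t) = sgn t"
        using q by (simp add: vr sgn_mult)
      ultimately show ?thesis by simp
    qed
  qed
  have "\<forall>\<^sub>F t in nhds 0. complex_of_real t \<in> ball 0 r"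
    using r(1) by (intro eventually_nhds_of_real eventually_nhds_in_open) auto
  with V_real inv have "\<forall>\<^sub>F t in nhds 0. complex_of_real t \<in> ball 0 r \<and> \<theta> (w + vr t) = c + t \<and>
      V (of_real t) = of_real (vr t) \<and> (t \<noteq> 0 \<longrightarrow> sgn (vr t) = sgn t)"
    by eventually_elim (auto simp: vr_def)
  then obtain d where d: "d > 0" and near: "\<And>t. \<bar>t\<bar> < d \<Longrightarrow>
      complex_of_real t \<in> ball 0 r \<and> \<theta> (w + vr t) = c + t \<and>
      V (of_real t) = of_real (vr t) \<and> (t \<noteq> 0 \<longrightarrow> sgn (vr t) = sgn t)"
    unfolding eventually_nhds_metric by (auto simp: dist_real_def)
  define e where "e = d / 2"
  have e: "e > 0" "e < d" using d by (auto simp: e_def)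
  have cont: "continuous_on {-e..e} vr"
  proof -
    have "continuous_on {-e..e} (\<lambda>t. Re (V (of_real t)))"
    proof (intro continuous_on_Re continuous_on_compose2[OF holomorphic_on_imp_continuous_on[OF holV]])
      show "complex_of_real ` {-e..e} \<subseteq> ball 0 r" using near e by fastforce
    qed (intro continuous_intros)
    then show ?thesis
      by (rule continuous_on_eq) (use near e in auto)
  qed
  have signs: "vr (-e) < 0" "0 < vr e"
    using near[of e] near[of "-e"] e by (auto simp: sgn_1_pos sgn_1_neg)
  have "\<forall>\<^sub>F s in nhds 0. s \<in> {vr (-e)<..<vr e}"
    using signs by (intro eventually_nhds_in_open) auto
  \<comment> \<open>The hypothesis \<open>inv\<close> describes \<theta> only at points
    \<open>w + vr t\<close>. Since \<open>vr\<close> is continuous and changes sign between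
    \<open>-e\<close> and \<open>e\<close>, these points fill a neighbourhood of
    \<open>w\<close>.\<close>
  then have "\<forall>\<^sub>F s in nhds 0. T (of_real s) + of_real c = of_real (\<theta> (w + s))"
  proof eventually_elim
    case (elim s)
    then obtain t where t: "-e \<le> t" "t \<le> e" "vr t = s"
      using IVT'[of vr "-e" s e] cont e by auto
    then have "\<bar>t\<bar> < d" using e by auto
    from near[OF this] have "T (of_real s) = of_real t" "\<theta> (w + s) = c + t"
      using T(2) t(3) by metis+
    then show ?case by simp
  qed
  moreover have "(\<lambda>z. T z + of_real c) has_fps_expansion B + fps_const (of_real c)"
    by (intro fps_expansion_intros B)
  ultimately have "has_complex_expansion \<theta> w (B + fps_const (of_real c))"
    unfolding has_complex_expansion_def by blast
  moreover have "A oo (B + fps_const (of_real c) - fps_const (of_real c)) = fps_const (1/2) * fps_X ^ 2"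
    using eq by simp
  ultimately show ?thesis by blast
qed

section \<open>Orders of the coefficients of an inverted power series\<close>

text \<open>The coefficient is a sum of products of r coefficients of \<open>T\<close> with indices
  at least 1 adding up to \<open>n\<close>, so the exponents j - 1 add up to n - r. Each index is
  then at most n - r + 1, which \<open>n < N + r\<close> keeps within the range where
  \<open>T\<close> is controlled; the induction hypothesis of a later strong induction can thus be
  plugged in.\<close>

lemma fps_power_nth_bigo:
  fixes T :: "real \<Rightarrow> complex fps"
  assumes T0: "\<And>e. fps_nth (T e) 0 = 0"
    and T: "\<And>j. 1 \<le> j \<Longrightarrow> j \<le> N \<Longrightarrow> (\<lambda>e. fps_nth (T e) j) \<in> O[F](\<lambda>e. of_real e ^ (j - 1))"
    and "n < N + r"
  shows "(\<lambda>e. fps_nth (T e ^ r) n) \<in> O[F](\<lambda>e. of_real e ^ (n - r))"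
  using \<open>n < N + r\<close>
proof (induction r arbitrary: n)
  case 0
  then show ?case by (cases "n = 0") auto
next
  case (Suc r)
  have "(\<lambda>e. fps_nth (T e) i * fps_nth (T e ^ r) (n - i)) \<in> O[F](\<lambda>e. of_real e ^ (n - Suc r))"
    if i: "i \<in> {0..n}" for i
  proof (cases "i = 0 \<or> n - i < r")
    \<comment> \<open>This case covers the products that vanish: \<open>T\<close> has no constant
      term, and \<open>T ^ r\<close> starts at degree \<open>r\<close>. Truncated subtraction in the
      exponent therefore does no harm.\<close>
    case True
    have *: "fps_nth (T e) i * fps_nth (T e ^ r) (n - i) = 0" for e
      using True T0[of e] startsby_zero_power_prefix[of "T e" r] by auto
    show ?thesis unfolding * by simp
  next
    case False
    then have "1 \<le> i" "i \<le> N" "n - i < N + r" and e: "n - Suc r = (i - 1) + (n - i - r)"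
      using Suc.prems i by auto
    then have "(\<lambda>e. fps_nth (T e) i * fps_nth (T e ^ r) (n - i))
        \<in> O[F](\<lambda>e. of_real e ^ (i - 1) * of_real e ^ (n - i - r))"
      by (intro landau_o.big.mult T Suc.IH)
    then show ?thesis unfolding e power_add .
  qed
  then show ?case
    unfolding power_Suc fps_mult_nth by (rule big_sum_in_bigo)
qed

text \<open>The coefficient of v^(m+1) in T^2 contains T_m only in the two products with T_1, and
  the powers from the third on involve only indices up to m - 1, because T has no constant term.
  Multiplying by T_1 turns the factor of T_m into 2 A_2 T_1^2, which the first part replaces by
  1.\<close>

lemma fps_compose_eq_half_square_recurrence:
  fixes A T :: "complex fps"
  assumes A: "fps_nth A 0 = 0" "fps_nth A 1 = 0"
    and T0: "fps_nth T 0 = 0"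
    and eq: "A oo T = fps_const (1/2) * fps_X ^ 2"
  shows "2 * fps_nth A 2 * fps_nth T 1 ^ 2 = 1"
    and "2 \<le> m \<Longrightarrow> fps_nth T m = - fps_nth T 1 *
           (fps_nth A 2 * (\<Sum>i=2..m-1. fps_nth T i * fps_nth T (m + 1 - i)) +
            (\<Sum>r=3..m+1. fps_nth A r * fps_nth (T ^ r) (m + 1)))"
proof -
  have nth: "(\<Sum>r=2..n. fps_nth A r * fps_nth (T ^ r) n) = (if n = 2 then 1/2 else 0)"
    if "2 \<le> n" for n
  proof -
    have "(\<Sum>r=2..n. fps_nth A r * fps_nth (T ^ r) n) = (\<Sum>r=0..n. fps_nth A r * fps_nth (T ^ r) n)"
    proof (rule sum.mono_neutral_left)
      show "\<forall>i\<in>{0..n} - {2..n}. fps_nth A i * fps_nth (T ^ i) n = 0"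
      proof
        fix i assume "i \<in> {0..n} - {2..n}"
        then have "i = 0 \<or> i = 1" by auto
        then show "fps_nth A i * fps_nth (T ^ i) n = 0" using A by auto
      qed
    qed auto
    also have "\<dots> = fps_nth (fps_const (1/2) * fps_X ^ 2) n"
      by (simp add: eq[symmetric] fps_compose_nth)
    also have "\<dots> = (if n = 2 then 1/2 else 0)" by simp
    finally show ?thesis .
  qed
  have sq: "fps_nth (T ^ 2) n = (\<Sum>i=1..n-1. fps_nth T i * fps_nth T (n - i))" if "2 \<le> n" for n
  proof -
    have "fps_nth (T ^ 2) n = (\<Sum>i=0..n. fps_nth T i * fps_nth T (n - i))"
      by (simp add: power2_eq_square fps_mult_nth)
    also have "\<dots> = (\<Sum>i=1..n-1. fps_nth T i * fps_nth T (n - i))"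
    proof (rule sum.mono_neutral_right)
      show "\<forall>i\<in>{0..n} - {1..n-1}. fps_nth T i * fps_nth T (n - i) = 0"
      proof
        fix i assume "i \<in> {0..n} - {1..n-1}"
        then have "i = 0 \<or> i = n" by auto
        then show "fps_nth T i * fps_nth T (n - i) = 0" using T0 by auto
      qed
    qed auto
    finally show ?thesis .
  qed
  show T1: "2 * fps_nth A 2 * fps_nth T 1 ^ 2 = 1"
    using nth[of 2] sq[of 2] by (simp add: power2_eq_square mult_ac)
  assume m: "2 \<le> m"
  let ?S = "\<Sum>i=2..m-1. fps_nth T i * fps_nth T (m + 1 - i)"
  let ?R = "\<Sum>r=3..m+1. fps_nth A r * fps_nth (T ^ r) (m + 1)"
  have "fps_nth (T ^ 2) (m + 1) = (\<Sum>i=1..m. fps_nth T i * fps_nth T (m + 1 - i))"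
    using sq[of "m + 1"] m by simp
  also have "\<dots> = fps_nth T 1 * fps_nth T m + (\<Sum>i=2..m. fps_nth T i * fps_nth T (m + 1 - i))"
    using m by (simp add: sum.atLeast_Suc_atMost numeral_2_eq_2)
  also have "{2..m} = insert m {2..m-1}" using m by auto
  also have "(\<Sum>i\<in>insert m {2..m-1}. fps_nth T i * fps_nth T (m + 1 - i)) = fps_nth T m * fps_nth T 1 + ?S"
    using m by (subst sum.insert) auto
  finally have T2: "fps_nth (T ^ 2) (m + 1) = 2 * fps_nth T 1 * fps_nth T m + ?S" by simp
  have "{2..m+1} = insert 2 {3..m+1}" using m by auto
  then have "0 = fps_nth A 2 * fps_nth (T ^ 2) (m + 1) + ?R"
    using nth[of "m + 1"] m by simp
  then have "fps_nth A 2 * 2 * fps_nth T 1 * fps_nth T m = - (fps_nth A 2 * ?S + ?R)"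
    unfolding T2 by (simp add: algebra_simps add_eq_0_iff)
  moreover have "(2 * fps_nth A 2 * fps_nth T 1 ^ 2) * fps_nth T m =
      fps_nth T 1 * (fps_nth A 2 * 2 * fps_nth T 1 * fps_nth T m)"
    by (simp add: power2_eq_square)
  ultimately have "(2 * fps_nth A 2 * fps_nth T 1 ^ 2) * fps_nth T m =
      - fps_nth T 1 * (fps_nth A 2 * ?S + ?R)"
    by (simp only: mult_minus_left mult_minus_right)
  then show "fps_nth T m = - fps_nth T 1 * (fps_nth A 2 * ?S + ?R)"
    unfolding T1 by simp
qed

text \<open>Strong induction along the recurrence, in which every product has total exponent m - 1.
  The lower bound on A_2 bounds T_1, since 2 |A_2| |T_1|^2 = 1 gives |T_1|^2 \<le> 1/(2d).\<close>

lemma inverse_fps_nth_bigo: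
  fixes A T :: "real \<Rightarrow> complex fps"
  assumes A0: "\<And>e. fps_nth (A e) 0 = 0" "\<And>e. fps_nth (A e) 1 = 0"
    and T0: "\<And>e. fps_nth (T e) 0 = 0"
    and eq: "\<forall>\<^sub>F e in F. A e oo T e = fps_const (1/2) * fps_X ^ 2"
    and A: "\<And>r. 2 \<le> r \<Longrightarrow> (\<lambda>e. fps_nth (A e) r) \<in> O[F](\<lambda>e. of_real e ^ (r - 2))"
    and lower: "d > 0" "\<forall>\<^sub>F e in F. d \<le> norm (fps_nth (A e) 2)"
    and "1 \<le> n"
  shows "(\<lambda>e. fps_nth (T e) n) \<in> O[F](\<lambda>e. of_real e ^ (n - 1))"
  using \<open>1 \<le> n\<close>
proof (induction n rule: less_induct)
  case (less m)
  have T1: "(\<lambda>e. fps_nth (T e) 1) \<in> O[F](\<lambda>_. 1)"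
  proof (rule bigoI)
    show "\<forall>\<^sub>F e in F. norm (fps_nth (T e) 1) \<le> sqrt (1 / (2 * d)) * norm (1::complex)"
      using eq lower(2)
    proof eventually_elim
      case (elim e)
      have "2 * norm (fps_nth (A e) 2) * norm (fps_nth (T e) 1) ^ 2 = 1"
        using arg_cong[OF fps_compose_eq_half_square_recurrence(1)[OF A0 T0 elim(1)], of norm]
        by (simp add: norm_mult norm_power)
      moreover have "2 * d * norm (fps_nth (T e) 1) ^ 2 \<le> 2 * norm (fps_nth (A e) 2) * norm (fps_nth (T e) 1) ^ 2"
        using elim(2) by (intro mult_right_mono) auto
      ultimately have "norm (fps_nth (T e) 1) ^ 2 \<le> 1 / (2 * d)"
        using lower(1) by (simp add: field_simps)
      then show ?case by (simp add: real_le_rsqrt)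
    qed
  qed
  show ?case
  proof (cases "m = 1")
    case True
    then show ?thesis using T1 by simp
  next
    case False
    with less.prems have m: "2 \<le> m" by simp
    let ?E = "\<lambda>e::real. complex_of_real e ^ (m - 1)"
    have "(\<lambda>e. fps_nth (T e) i * fps_nth (T e) (m + 1 - i)) \<in> O[F](?E)" if "i \<in> {2..m-1}" for i
    proof -
      have "(\<lambda>e. fps_nth (T e) i * fps_nth (T e) (m + 1 - i))
              \<in> O[F](\<lambda>e. of_real e ^ (i - 1) * of_real e ^ (m + 1 - i - 1))"
        using that by (intro landau_o.big.mult less.IH) auto
      moreover have "m - 1 = (i - 1) + (m + 1 - i - 1)" using that by auto
      ultimately show ?thesis by (simp only: power_add)
    qed
    then have "(\<lambda>e. \<Sum>i=2..m-1. fps_nth (T e) i * fps_nth (T e) (m + 1 - i)) \<in> O[F](?E)"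
      by (rule big_sum_in_bigo)
    with A[of 2] have S: "(\<lambda>e. fps_nth (A e) 2 * (\<Sum>i=2..m-1. fps_nth (T e) i * fps_nth (T e) (m + 1 - i)))
         \<in> O[F](?E)"
      using landau_o.big.mult[of "\<lambda>e. fps_nth (A e) 2" F "\<lambda>_. 1" _ ?E] by simp
    have "(\<lambda>e. fps_nth (A e) r * fps_nth (T e ^ r) (m + 1)) \<in> O[F](?E)" if "r \<in> {3..m+1}" for r
    proof -
      have "(\<lambda>e. fps_nth (A e) r * fps_nth (T e ^ r) (m + 1))
              \<in> O[F](\<lambda>e. of_real e ^ (r - 2) * of_real e ^ (m + 1 - r))"
        \<comment> \<open>With \<open>N = m - 1\<close> the side condition m + 1 < N + r says
          exactly that r is at least 3, and only indices below \<open>m\<close> are requested from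
          the induction hypothesis.\<close>
        using that by (intro landau_o.big.mult A fps_power_nth_bigo[where N = "m - 1"] T0 less.IH) auto
      moreover have "m - 1 = (r - 2) + (m + 1 - r)" using that by auto
      ultimately show ?thesis by (simp only: power_add)
    qed
    then have R: "(\<lambda>e. \<Sum>r=3..m+1. fps_nth (A e) r * fps_nth (T e ^ r) (m + 1)) \<in> O[F](?E)"
      by (rule big_sum_in_bigo)
    let ?rhs = "\<lambda>e. - fps_nth (T e) 1 *
         (fps_nth (A e) 2 * (\<Sum>i=2..m-1. fps_nth (T e) i * fps_nth (T e) (m + 1 - i)) +
          (\<Sum>r=3..m+1. fps_nth (A e) r * fps_nth (T e ^ r) (m + 1)))"
    have "?rhs \<in> O[F](\<lambda>e. 1 * ?E e)"
      using T1 by (intro landau_o.big.mult sum_in_bigo S R) simp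
    moreover have "\<forall>\<^sub>F e in F. ?rhs e = fps_nth (T e) m"
      using eq by eventually_elim (rule fps_compose_eq_half_square_recurrence(2)[OF A0 T0 _ m, symmetric])
    ultimately show ?thesis
      using landau_o.big.in_cong[of ?rhs "\<lambda>e. fps_nth (T e) m" F] by simp
  qed
qed

section \<open>Convexity of the domain and analyticity of the cumulant generating function\<close>

context real_distribution
begin

text \<open>On the line it suffices to show that the domain is an interval. For t between a and b,
  exp(t y) lies below exp(a y) or exp(b y) according to the sign of y, so their sum is an integrable
  majorant.\<close>

lemma convex_cgf_domain: "convex (cgf_domain M)"
proof -
  have "t \<in> cgf_domain M" if "a \<in> cgf_domain M" "b \<in> cgf_domain M" "a \<le> t" "t \<le> b" for a b t
  proof -
    have "integrable M (\<lambda>y. exp (a * y) + exp (b * y))"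
      using that by (auto simp: cgf_domain_def)
    then have "integrable M (\<lambda>y. exp (t * y))"
    proof (rule Bochner_Integration.integrable_bound)
      show "AE y in M. norm (exp (t * y)) \<le> norm (exp (a * y) + exp (b * y))"
      proof (intro AE_I2)
        fix y
        have "t * y \<le> a * y \<or> t * y \<le> b * y"
          using that by (cases "y \<ge> 0") (auto intro: mult_right_mono mult_right_mono_neg)
        then have "exp (t * y) \<le> exp (a * y) + exp (b * y)"
          by (auto intro: add_increasing add_increasing2)
        then show "norm (exp (t * y)) \<le> norm (exp (a * y) + exp (b * y))" by simp
      qed
    qed simp
    then show ?thesis by (simp add: cgf_domain_def)
  qed
  then have "is_interval (cgf_domain M)"
    unfolding is_interval_1 by blast
  then show ?thesis by (simp add: is_interval_convex)
qed

lemma mgf_pos: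
  assumes "t \<in> cgf_domain M"
  shows "0 < (\<integral>y. exp (t * y) \<partial>M)"
proof -
  have int: "integrable M (\<lambda>y. exp (t * y))" using assms by (simp add: cgf_domain_def)
  have "(\<integral>y. exp (t * y) \<partial>M) \<noteq> 0"
  proof
    assume "(\<integral>y. exp (t * y) \<partial>M) = 0"
    then have "AE y in M. exp (t * y) = 0"
      using integral_nonneg_eq_0_iff_AE[OF int] by simp
    then show False by simp
  qed
  moreover have "0 \<le> (\<integral>y. exp (t * y) \<partial>M)"
    by (rule integral_nonneg_AE) simp
  ultimately show ?thesis by linarith
qed

text \<open>Expand exp(h y) and integrate term by term against exp(c y). The resulting real power
  series converges on a neighbourhood of 0, and its sum at complex arguments is the witness, so no
  complex-valued integral has to be differentiated.\<close>

lemma mgf_has_complex_expansion: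
  assumes "c \<in> interior (cgf_domain M)"
  shows "\<exists>A. has_complex_expansion (\<lambda>t. \<integral>y. exp (t * y) \<partial>M) c A"
proof -
  obtain r where r: "r > 0" "cball c r \<subseteq> cgf_domain M"
    using assms by (auto simp: mem_interior_cball)
  \<comment> \<open>An integrable majorant of exp(c y + r |y|), and thereby of all partial sums of
    absolute values of the series for |h| \<le> r.\<close>
  define B where "B = (\<lambda>y. exp ((c + r) * y) + exp ((c - r) * y))"
  have "c + r \<in> cgf_domain M" "c - r \<in> cgf_domain M"
    using r by (auto simp: dist_real_def)
  then have intB: "integrable M B"
    by (auto simp: B_def cgf_domain_def)
  define g where "g = (\<lambda>h n y. exp (c * y) * ((h * y) ^ n /\<^sub>R fact n))"
  have g_sums: "(\<lambda>n. g h n y) sums exp ((c + h) * y)" for h y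
    unfolding g_def using sums_mult[OF exp_converges[of "h * y"], of "exp (c * y)"]
    by (simp add: exp_add[symmetric] algebra_simps)
  have g_abs: "\<bar>g h n y\<bar> = exp (c * y) * ((\<bar>h\<bar> * \<bar>y\<bar>) ^ n /\<^sub>R fact n)" for h n y
    by (simp add: g_def abs_mult power_abs power_mult_distrib)
  have abs_sums: "(\<lambda>n. \<bar>g h n y\<bar>) sums (exp (c * y) * exp (\<bar>h\<bar> * \<bar>y\<bar>))" for h y
    unfolding g_abs by (intro sums_mult exp_converges)
  have partial: "(\<Sum>n<N. \<bar>g h n y\<bar>) \<le> B y" if "\<bar>h\<bar> \<le> r" for h N y
  proof -
    have "(\<Sum>n<N. \<bar>g h n y\<bar>) \<le> (\<Sum>n. \<bar>g h n y\<bar>)"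
      using abs_sums by (intro sum_le_suminf) (auto simp: sums_iff)
    also have "\<dots> = exp (c * y + \<bar>h\<bar> * \<bar>y\<bar>)"
      using abs_sums[of h y] by (simp add: sums_iff exp_add)
    also have "\<dots> \<le> exp (c * y + r * \<bar>y\<bar>)"
      using that by (simp add: mult_right_mono)
    also have "\<dots> \<le> B y"
      by (cases "y \<ge> 0") (auto simp: B_def algebra_simps)
    finally show ?thesis .
  qed
  have int_g: "integrable M (g h n)" if "\<bar>h\<bar> \<le> r" for h n
  proof (rule Bochner_Integration.integrable_bound[OF intB])
    show "AE y in M. norm (g h n y) \<le> norm (B y)"
    proof (intro AE_I2)
      fix y
      have "\<bar>g h n y\<bar> \<le> (\<Sum>k<Suc n. \<bar>g h k y\<bar>)"
        by (rule member_le_sum) auto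
      also have "\<dots> \<le> B y" using that by (rule partial)
      finally show "norm (g h n y) \<le> norm (B y)" by simp
    qed
  qed (simp add: g_def)
  define a where "a = (\<lambda>n. \<integral>y. exp (c * y) * (y ^ n /\<^sub>R fact n) \<partial>M)"
  have mgf_sums: "(\<lambda>n. a n * h ^ n) sums (\<integral>y. exp ((c + h) * y) \<partial>M)" if h: "\<bar>h\<bar> \<le> r" for h
  proof -
    have "(\<lambda>n. \<integral>y. g h n y \<partial>M) sums (\<integral>y. (\<Sum>n. g h n y) \<partial>M)"
    proof (rule sums_integral)
      show "summable (\<lambda>n. \<integral>y. norm (g h n y) \<partial>M)"
      proof (rule summableI_nonneg_bounded)
        fix N
        have "(\<Sum>n<N. \<integral>y. norm (g h n y) \<partial>M) = (\<integral>y. (\<Sum>n<N. norm (g h n y)) \<partial>M)"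
          using int_g[OF h] by (intro Bochner_Integration.integral_sum[symmetric]) simp
        also have "\<dots> \<le> (\<integral>y. B y \<partial>M)"
          using int_g[OF h] partial[OF h] intB by (intro integral_mono) auto
        finally show "(\<Sum>n<N. \<integral>y. norm (g h n y) \<partial>M) \<le> (\<integral>y. B y \<partial>M)" .
      qed simp
      show "AE y in M. summable (\<lambda>n. norm (g h n y))"
        using abs_sums by (auto simp: sums_iff)
    qed (rule int_g[OF h])
    moreover have "(\<Sum>n. g h n y) = exp ((c + h) * y)" for y
      using g_sums by (simp add: sums_iff)
    moreover have "(\<integral>y. g h n y \<partial>M) = a n * h ^ n" for n
    proof -
      have "(\<integral>y. g h n y \<partial>M) = (\<integral>y. exp (c * y) * (y ^ n /\<^sub>R fact n) * h ^ n \<partial>M)"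
        by (intro Bochner_Integration.integral_cong) (simp_all add: g_def power_mult_distrib)
      then show ?thesis by (simp add: a_def)
    qed
    ultimately show ?thesis by simp
  qed
  define A where "A = Abs_fps (\<lambda>n. complex_of_real (a n))"
  have A_sums: "(\<lambda>n. fps_nth A n * of_real h ^ n) sums of_real (\<integral>y. exp ((c + h) * y) \<partial>M)"
    if "\<bar>h\<bar> \<le> r" for h
    using sums_of_real[OF mgf_sums[OF that], where 'a=complex] by (simp add: A_def)
  \<comment> \<open>Convergence at the single real point \<open>r\<close> bounds the radius of
    convergence from below, also for complex arguments.\<close>
  have "fps_conv_radius A \<ge> norm (complex_of_real r)"
    unfolding fps_conv_radius_def using A_sums[of r] r(1)
    by (intro conv_radius_geI) (auto simp: sums_iff)
  then have "fps_conv_radius A > 0"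
    using r(1) by (metis less_le_trans ereal_less(2) norm_of_real abs_of_pos)
  then have "eval_fps A has_fps_expansion A"
    by (rule eval_fps_has_fps_expansion)
  moreover have "\<forall>\<^sub>F h in nhds 0. h \<in> ball 0 r"
    using r(1) by (intro eventually_nhds_in_open) auto
  then have "\<forall>\<^sub>F h in nhds 0. eval_fps A (of_real h) = of_real (\<integral>y. exp ((c + h) * y) \<partial>M)"
  proof eventually_elim
    case (elim h)
    then show ?case using A_sums[of h] by (simp add: eval_fps_def sums_iff)
  qed
  ultimately show ?thesis
    unfolding has_complex_expansion_def by blast
qed

lemma cgf_has_complex_expansion:
  assumes "c \<in> interior (cgf_domain M)"
  shows "\<exists>A. has_complex_expansion (cgf M) c A"
proof -
  obtain A where "has_complex_expansion (\<lambda>t. \<integral>y. exp (t * y) \<partial>M) c A"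
    using mgf_has_complex_expansion[OF assms] by blast
  then have "\<exists>B. has_complex_expansion (\<lambda>t. ln (\<integral>y. exp (t * y) \<partial>M)) c B"
    using mgf_pos[of c] assms interior_subset by (intro has_complex_expansion_ln) auto
  then show ?thesis by (simp add: cgf_def[abs_def])
qed

lemma DERIV_cgf_higher_deriv:
  assumes "c \<in> interior (cgf_domain M)"
  shows "((deriv ^^ n) (cgf M) has_field_derivative (deriv ^^ Suc n) (cgf M) c) (at c)"
  using cgf_has_complex_expansion[OF assms] has_complex_expansion_higher_deriv
    has_complex_expansion_DERIV by fastforce

end

section \<open>The saddlepoint and the local inverse around it\<close>

text \<open>The Taylor series of K(\<theta>) - x \<theta>, minus its value at the saddlepoint,
  around the saddlepoint. The first two coefficients are set to 0 outright, so that their vanishing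
  holds for every measure and not only where the saddlepoint is known to exist.\<close>

definition saddle_cgf_fps :: "real measure \<Rightarrow> real \<Rightarrow> complex fps" where
  "saddle_cgf_fps M x = Abs_fps (\<lambda>r. if r < 2 then 0
     else of_real ((deriv ^^ r) (cgf M) (saddlepoint M x)) / fact r)"

text \<open>The Taylor series of \<theta>(w) minus the saddlepoint around \<open>w_hat\<close>,
  again with the constant coefficient set to 0 unconditionally.\<close>

definition saddle_inverse_fps :: "real measure \<Rightarrow> real \<Rightarrow> complex fps" where
  "saddle_inverse_fps M x = Abs_fps (\<lambda>n. if n = 0 then 0
     else of_real (theta_hat_deriv n M x) / fact n)"

text \<open>Collects what is used of a single member of the family. The bound \<open>d\<close> is a
  parameter, so that one value serves all \<epsilon> and the estimates are uniform.\<close>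

locale strongly_convex_cgf = real_distribution +
  fixes d :: real
  assumes d_pos: "0 < d"
    and cgf_deriv2_ge: "\<And>t. t \<in> interior (cgf_domain M) \<Longrightarrow> d \<le> (deriv ^^ 2) (cgf M) t"
    and deriv_cgf_onto: "deriv (cgf M) ` interior (cgf_domain M) = UNIV"
begin

lemma interior_cgf_domain_interval:
  "a \<in> interior (cgf_domain M) \<Longrightarrow> b \<in> interior (cgf_domain M) \<Longrightarrow> a \<le> t \<Longrightarrow> t \<le> b
    \<Longrightarrow> t \<in> interior (cgf_domain M)"
  using convex_interior[OF convex_cgf_domain] is_interval_convex_1 mem_is_interval_1_I by blast

text \<open>Mean value theorem for K'. The quantitative form serves both the uniqueness of the
  saddlepoint and the bound on its size.\<close>

lemma deriv_cgf_growth: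
  assumes "a \<in> interior (cgf_domain M)" "b \<in> interior (cgf_domain M)" "a \<le> b"
  shows "d * (b - a) \<le> deriv (cgf M) b - deriv (cgf M) a"
proof (cases "a = b")
  case False
  have "\<exists>z>a. z < b \<and> deriv (cgf M) b - deriv (cgf M) a = (b - a) * (deriv ^^ 2) (cgf M) z"
  proof (rule MVT2)
    show "a < b" using assms False by simp
    fix t assume "a \<le> t" "t \<le> b"
    then have "t \<in> interior (cgf_domain M)" using interior_cgf_domain_interval assms by blast
    from DERIV_cgf_higher_deriv[OF this, of 1]
    show "(deriv (cgf M) has_real_derivative (deriv ^^ 2) (cgf M) t) (at t)"
      by (simp add: numeral_2_eq_2)
  qed
  then obtain z where z: "a < z" "z < b"
    "deriv (cgf M) b - deriv (cgf M) a = (b - a) * (deriv ^^ 2) (cgf M) z" by blast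
  then have "d \<le> (deriv ^^ 2) (cgf M) z"
    using interior_cgf_domain_interval[OF assms(1,2)] by (intro cgf_deriv2_ge) simp
  then show ?thesis
    using z(3) assms(3) mult_left_mono[of d _ "b - a"] by (simp add: mult.commute[of d])
qed simp

lemma deriv_cgf_strict_mono:
  assumes "a \<in> interior (cgf_domain M)" "b \<in> interior (cgf_domain M)" "a < b"
  shows "deriv (cgf M) a < deriv (cgf M) b"
proof -
  have "0 < d * (b - a)" using d_pos assms by simp
  then show ?thesis using deriv_cgf_growth[OF assms(1,2)] assms(3) by simp
qed

text \<open>Surjectivity and strict monotonicity of K' make the definite description in the
  definition of \<open>saddlepoint\<close> proper.\<close>

lemma saddlepoint:
  shows saddlepoint_interior: "saddlepoint M x \<in> interior (cgf_domain M)"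
    and deriv_cgf_saddlepoint: "deriv (cgf M) (saddlepoint M x) = x"
proof -
  have "\<exists>!t. t \<in> interior (cgf_domain M) \<and> deriv (cgf M) t = x"
  proof -
    obtain t where "t \<in> interior (cgf_domain M)" "deriv (cgf M) t = x"
      using deriv_cgf_onto by (metis UNIV_I imageE)
    moreover have "s = t"
      if "s \<in> interior (cgf_domain M)" "t \<in> interior (cgf_domain M)"
        "deriv (cgf M) s = deriv (cgf M) t" for s t
      using deriv_cgf_strict_mono[of s t] deriv_cgf_strict_mono[of t s] that
      by (metis less_irrefl linorder_neqE_linordered_idom)
    ultimately show ?thesis by metis
  qed
  from theI'[OF this]
  show "saddlepoint M x \<in> interior (cgf_domain M)" "deriv (cgf M) (saddlepoint M x) = x"
    unfolding saddlepoint_def by auto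
qed

text \<open>Growth of K' between 0 and the saddlepoint, where K' equals x. Once K'(0) is bounded
  along the family, all saddlepoints lie in one compact interval.\<close>

lemma saddlepoint_bound:
  assumes "0 \<in> interior (cgf_domain M)"
  shows "\<bar>saddlepoint M x\<bar> \<le> \<bar>x - deriv (cgf M) 0\<bar> / d"
proof -
  have "d * \<bar>saddlepoint M x\<bar> \<le> \<bar>x - deriv (cgf M) 0\<bar>"
    using deriv_cgf_growth[OF assms saddlepoint_interior, of x]
      deriv_cgf_growth[OF saddlepoint_interior assms, of x] deriv_cgf_saddlepoint[of x]
    by (cases "saddlepoint M x \<ge> 0") (auto simp: abs_if)
  then show ?thesis using d_pos by (simp add: field_simps)
qed

definition saddle_excess :: "real \<Rightarrow> real \<Rightarrow> real" where
  "saddle_excess x t = (cgf M t - x * t) - (cgf M (saddlepoint M x) - x * saddlepoint M x)"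

lemma DERIV_saddle_excess:
  assumes "t \<in> interior (cgf_domain M)"
  shows "(saddle_excess x has_real_derivative deriv (cgf M) t - x) (at t)"
  unfolding saddle_excess_def using DERIV_cgf_higher_deriv[OF assms, of 0]
  by (auto intro!: derivative_eq_intros)

text \<open>To the right of the saddlepoint K' exceeds x, so the mean value theorem gives a positive
  increment; the left side is the mirror image.\<close>

lemma saddle_excess_strict_mono:
  assumes "saddlepoint M x \<le> a" "a < b" "b \<in> interior (cgf_domain M)"
  shows "saddle_excess x a < saddle_excess x b"
proof -
  have dom: "t \<in> interior (cgf_domain M)" if "a \<le> t" "t \<le> b" for t
    using interior_cgf_domain_interval[OF saddlepoint_interior[of x] assms(3), of t] assms(1) that by simp
  have "\<exists>z>a. z < b \<and> saddle_excess x b - saddle_excess x a = (b - a) * (deriv (cgf M) z - x)"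
    using assms(2) dom by (intro MVT2 DERIV_saddle_excess)
  then obtain z where z: "a < z" "z < b"
    "saddle_excess x b - saddle_excess x a = (b - a) * (deriv (cgf M) z - x)" by blast
  then have "x < deriv (cgf M) z"
    using deriv_cgf_strict_mono[OF saddlepoint_interior[of x] dom, of z] deriv_cgf_saddlepoint[of x] assms(1)
    by simp
  then have "0 < saddle_excess x b - saddle_excess x a" unfolding z(3) using assms(2) by simp
  then show ?thesis by simp
qed

lemma saddle_excess_strict_antimono:
  assumes "b \<le> saddlepoint M x" "a < b" "a \<in> interior (cgf_domain M)"
  shows "saddle_excess x b < saddle_excess x a"
proof -
  have dom: "t \<in> interior (cgf_domain M)" if "a \<le> t" "t \<le> b" for t
    using interior_cgf_domain_interval[OF assms(3) saddlepoint_interior[of x], of t] assms(1) that by simp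
  have "\<exists>z>a. z < b \<and> saddle_excess x b - saddle_excess x a = (b - a) * (deriv (cgf M) z - x)"
    using assms(2) dom by (intro MVT2 DERIV_saddle_excess)
  then obtain z where z: "a < z" "z < b"
    "saddle_excess x b - saddle_excess x a = (b - a) * (deriv (cgf M) z - x)" by blast
  then have "deriv (cgf M) z < x"
    using deriv_cgf_strict_mono[OF dom saddlepoint_interior[of x], of z] deriv_cgf_saddlepoint[of x] assms(1)
    by simp
  then have "saddle_excess x b - saddle_excess x a < 0"
    unfolding z(3) using assms(2) by (simp add: mult_less_0_iff)
  then show ?thesis by simp
qed

lemma saddle_excess_saddlepoint [simp]: "saddle_excess x (saddlepoint M x) = 0"
  by (simp add: saddle_excess_def)

lemma saddle_excess_pos:
  assumes "t \<in> interior (cgf_domain M)" "t \<noteq> saddlepoint M x"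
  shows "0 < saddle_excess x t"
  using saddle_excess_strict_mono[of x "saddlepoint M x" t]
    saddle_excess_strict_antimono[of "saddlepoint M x" x t] assms
  by (cases "saddlepoint M x < t") auto

lemma w_fun_saddle_excess:
  "w_fun M x t = w_hat M x + sgn_pm (t - saddlepoint M x) * sqrt (2 * saddle_excess x t)"
  by (simp only: w_fun_def saddle_excess_def Let_def)

text \<open>Strict monotonicity, by position relative to the saddlepoint: on the right the root of
  the excess increases, on the left it decreases but carries a minus sign, and across the
  saddlepoint the signs separate the values. This makes \<open>theta_fun\<close> a genuine left
  inverse of \<open>w_fun\<close>.\<close>

lemma inj_on_w_fun: "inj_on (w_fun M x) (interior (cgf_domain M))"
proof -
  have "w_fun M x s < w_fun M x t"
    if s: "s \<in> interior (cgf_domain M)" and t: "t \<in> interior (cgf_domain M)" and "s < t" for s t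
  proof -
    consider "saddlepoint M x \<le> s" | "s < saddlepoint M x" "saddlepoint M x \<le> t"
      | "t < saddlepoint M x"
      by linarith
    then show ?thesis
    proof cases
      case 1
      then show ?thesis
        using saddle_excess_strict_mono[OF _ \<open>s < t\<close> t] \<open>s < t\<close>
        by (simp add: w_fun_saddle_excess sgn_pm_def)
    next
      case 2
      have "0 \<le> saddle_excess x t" using saddle_excess_pos[OF t, of x] by (cases "t = saddlepoint M x") auto
      with 2 show ?thesis
        using saddle_excess_pos[OF s, of x]
        by (auto simp: w_fun_saddle_excess sgn_pm_def intro: less_le_trans[of _ 0])
    next
      case 3
      then show ?thesis
        using saddle_excess_strict_antimono[OF _ \<open>s < t\<close> s, of x] \<open>s < t\<close>
        by (simp add: w_fun_saddle_excess sgn_pm_def)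
    qed
  qed
  then show ?thesis
    by (metis inj_onI less_irrefl linorder_neqE_linordered_idom)
qed

text \<open>Subtracting an affine function changes only the first two Taylor coefficients of K. The
  constant one cancels by construction, the linear one because K' equals x at the
  saddlepoint.\<close>

lemma saddle_excess_has_complex_expansion:
  "has_complex_expansion (saddle_excess x) (saddlepoint M x) (saddle_cgf_fps M x)"
proof -
  let ?s = "saddlepoint M x"
  obtain A where A: "has_complex_expansion (cgf M) ?s A"
    using cgf_has_complex_expansion[OF saddlepoint_interior] by blast
  then obtain F where F: "F has_fps_expansion A"
    and ev: "\<forall>\<^sub>F t in nhds 0. F (of_real t) = of_real (cgf M (?s + t))"
    by (auto simp: has_complex_expansion_def)
  have "(\<lambda>z. F z - of_real (cgf M ?s) - of_real x * z) has_fps_expansion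
      A - fps_const (of_real (cgf M ?s)) - fps_const (of_real x) * fps_X"
    by (intro fps_expansion_intros F)
  moreover have "\<forall>\<^sub>F t in nhds 0. F (of_real t) - of_real (cgf M ?s) - of_real x * of_real t
      = of_real (saddle_excess x (?s + t))"
    using ev by eventually_elim (simp add: saddle_excess_def algebra_simps)
  ultimately have "has_complex_expansion (saddle_excess x) ?s
      (A - fps_const (of_real (cgf M ?s)) - fps_const (of_real x) * fps_X)"
    unfolding has_complex_expansion_def by blast
  moreover have "A - fps_const (of_real (cgf M ?s)) - fps_const (of_real x) * fps_X = saddle_cgf_fps M x"
  proof (rule fps_ext)
    fix n :: nat
    consider "n = 0" | "n = 1" | "2 \<le> n" by linarith
    then show "fps_nth (A - fps_const (of_real (cgf M ?s)) - fps_const (of_real x) * fps_X) n =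
        fps_nth (saddle_cgf_fps M x) n"
      by cases (auto simp: saddle_cgf_fps_def has_complex_expansion_nth[OF A] deriv_cgf_saddlepoint)
  qed
  ultimately show ?thesis by simp
qed

text \<open>The excess has a double zero at the saddlepoint with second derivative at least
  \<open>d\<close>, so the inversion of the signed square root applies to it; injectivity of
  \<open>w_fun\<close> supplies the inverse relation.\<close>

lemma saddle_fps_compose:
  "saddle_cgf_fps M x oo saddle_inverse_fps M x = fps_const (1/2) * fps_X ^ 2"
proof -
  let ?s = "saddlepoint M x"
  note E = saddle_excess_has_complex_expansion[of x]
  have d1: "deriv (saddle_excess x) ?s = 0"
    using DERIV_imp_deriv[OF DERIV_saddle_excess[OF saddlepoint_interior]] deriv_cgf_saddlepoint
    by simp
  have "complex_of_real ((deriv ^^ 2) (saddle_excess x) ?s) = of_real ((deriv ^^ 2) (cgf M) ?s)"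
    using has_complex_expansion_nth[OF E, of 2] by (simp add: saddle_cgf_fps_def)
  then have "(deriv ^^ 2) (saddle_excess x) ?s = (deriv ^^ 2) (cgf M) ?s"
    by (simp only: of_real_eq_iff)
  then have d2: "(deriv ^^ 2) (saddle_excess x) ?s > 0"
    using cgf_deriv2_ge[OF saddlepoint_interior, of x] d_pos by linarith
  \<comment> \<open>The form \<open>?s + 0\<close> matches the limit that \<open>tendsto_add\<close>
    produces for the translation by \<open>?s\<close>.\<close>
  have "\<forall>\<^sub>F t in nhds (?s + 0). t \<in> interior (cgf_domain M)"
    using saddlepoint_interior by (intro eventually_nhds_in_open) auto
  then have "\<forall>\<^sub>F t in nhds 0. ?s + t \<in> interior (cgf_domain M)"
    by (rule eventually_compose_filterlim) (intro tendsto_add tendsto_const filterlim_ident)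
  then have inv: "\<forall>\<^sub>F t in nhds 0.
      theta_fun M x (w_hat M x + sgn_pm t * sqrt (2 * saddle_excess x (?s + t))) = ?s + t"
  proof eventually_elim
    case (elim t)
    have "w_fun M x (?s + t) = w_hat M x + sgn_pm t * sqrt (2 * saddle_excess x (?s + t))"
      by (simp add: w_fun_saddle_excess)
    then show ?case
      unfolding theta_fun_def using inv_into_f_f[OF inj_on_w_fun elim] by metis
  qed
  obtain T where T: "has_complex_expansion (theta_fun M x) (w_hat M x) T"
    "saddle_cgf_fps M x oo (T - fps_const (of_real ?s)) = fps_const (1/2) * fps_X ^ 2"
    using has_complex_expansion_signed_sqrt_inverse[OF E saddle_excess_saddlepoint d1 d2 inv] by blast
  \<comment> \<open>The inverse relation at t = 0, where the root vanishes. It identifies the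
    constant coefficient of \<open>T\<close>, which the subtraction then cancels.\<close>
  have "theta_fun M x (w_hat M x) = ?s"
    using eventually_nhds_x_imp_x[OF inv] by simp
  then have "T - fps_const (of_real ?s) = saddle_inverse_fps M x"
    by (intro fps_ext)
      (auto simp: saddle_inverse_fps_def theta_hat_deriv_def has_complex_expansion_nth[OF T(1)])
  then show ?thesis using T(2) by simp
qed

end

section \<open>Double factorials and the tail of the expansion\<close>

text \<open>One induction step contributes 2m+3 on the left and 4 (2m+2) on the right. The generous
  factor 4 is what halving the base of a power with exponent 2m gains.\<close>

lemma odd_double_fact_le: "double_fact (2 * m + 1) \<le> 4 ^ m * double_fact (2 * m)"
proof (induction m)
  case (Suc m)
  \<comment> \<open>The recursion equation matches only arguments of the form
    \<open>Suc (Suc n)\<close>, hence the explicit renaming.\<close>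
  have "double_fact (Suc (Suc (2 * m + 1))) = Suc (Suc (2 * m + 1)) * double_fact (2 * m + 1)"
    "double_fact (Suc (Suc (2 * m))) = Suc (Suc (2 * m)) * double_fact (2 * m)"
    by (rule double_fact.simps)+
  moreover have "Suc (Suc (2 * m + 1)) = 2 * Suc m + 1" "Suc (Suc (2 * m)) = 2 * Suc m"
    by arith+
  moreover have "2 * Suc m + 1 = 2 * m + 3" "2 * Suc m = 2 * m + 2"
    by arith+
  ultimately have step: "double_fact (2 * Suc m + 1) = (2 * m + 3) * double_fact (2 * m + 1)"
    "double_fact (2 * Suc m) = (2 * m + 2) * double_fact (2 * m)"
    by metis+
  have "(2 * m + 3) * double_fact (2 * m + 1) \<le> (4 * (2 * m + 2)) * (4 ^ m * double_fact (2 * m))"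
    by (rule mult_mono[OF _ Suc.IH]) simp_all
  then show ?case
    unfolding step by (simp add: algebra_simps del: double_fact.simps)
qed simp

lemma double_fact_pos: "0 < double_fact n"
  by (induction n rule: double_fact.induct) auto

lemma std_normal_density_le_1: "std_normal_density y \<le> 1"
proof -
  have "sqrt (2 * pi) \<ge> 1" using pi_gt3 by simp
  moreover have "exp (- y\<^sup>2 / 2) \<le> 1" by simp
  ultimately have "1 / sqrt (2 * pi) * exp (- y\<^sup>2 / 2) \<le> 1 * 1"
    by (intro mult_mono) (auto simp: field_simps)
  then show ?thesis by (simp add: std_normal_density_def)
qed

lemma abs_Theta_term_le:
  "\<bar>Theta_term m M x\<bar> \<le> \<bar>theta_hat_deriv (2 * m + 1) M x\<bar> / real (double_fact (2 * m))"
proof -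
  have "\<bar>Theta_term m M x\<bar> = std_normal_density (w_hat M x) *
      (\<bar>theta_hat_deriv (2 * m + 1) M x\<bar> / real (double_fact (2 * m)))"
    by (simp add: Theta_term_def abs_mult power_abs)
  also have "\<dots> \<le> 1 * (\<bar>theta_hat_deriv (2 * m + 1) M x\<bar> / real (double_fact (2 * m)))"
    by (intro mult_right_mono std_normal_density_le_1) simp
  finally show ?thesis by simp
qed

text \<open>The remainder is the sum of the terms with m > M. For 0 < \<epsilon> < q each is at most
  D_m \<epsilon>^(2m), and splitting off \<epsilon>^(2(M+1)) leaves a power of \<epsilon> that may
  be enlarged to the same power of q. The remaining convergent series is the constant.\<close>

lemma Theta_term_tail_bigo:
  fixes \<mu> :: "real \<Rightarrow> real measure" and C :: "nat \<Rightarrow> real"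
  assumes sums: "\<forall>\<^sub>F \<epsilon> in at_right 0. (\<lambda>m. Theta_term m (\<mu> \<epsilon>) x) sums S \<epsilon>"
    and pos: "0 < \<epsilon>\<^sub>2" "\<And>n. 1 \<le> n \<Longrightarrow> 0 < C n"
    and bound: "\<And>n \<epsilon>. 1 \<le> n \<Longrightarrow> 0 < \<epsilon> \<Longrightarrow> \<epsilon> \<le> \<epsilon>\<^sub>2 \<Longrightarrow> \<bar>theta_hat_deriv n (\<mu> \<epsilon>) x\<bar> \<le> C n * \<epsilon> ^ (n - 1)"
    and summ: "summable (\<lambda>n. C (Suc n) / real (double_fact (Suc n)) * \<epsilon>\<^sub>2 ^ Suc n)"
  shows "(\<lambda>\<epsilon>. S \<epsilon> - (\<Sum>m\<le>M. Theta_term m (\<mu> \<epsilon>) x)) \<in> O[at_right 0](\<lambda>\<epsilon>. \<epsilon> ^ (2 * (M + 1)))"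
proof -
  define D where "D = (\<lambda>m. C (2 * m + 1) / real (double_fact (2 * m)))"
  define q where "q = \<epsilon>\<^sub>2 / 2"
  have q: "0 < q" "q \<le> \<epsilon>\<^sub>2" using pos(1) by (auto simp: q_def)
  have D0: "0 \<le> D m" for m using pos(2)[of "2 * m + 1"] by (simp add: D_def)
  have "0 \<le> C (Suc n) / real (double_fact (Suc n)) * \<epsilon>\<^sub>2 ^ Suc n" for n
    using pos(1) pos(2)[of "Suc n"]
    by (intro mult_nonneg_nonneg divide_nonneg_nonneg zero_le_power) simp_all
  \<comment> \<open>The summation index is shifted by one, so the even positions
    \<open>2 * m\<close> pick out the odd orders 2m+1 that occur in
    \<open>Theta_term\<close>.\<close>
  then have "summable ((\<lambda>n. C (Suc n) / real (double_fact (Suc n)) * \<epsilon>\<^sub>2 ^ Suc n) \<circ> (\<lambda>m. 2 * m))"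
    using summ by (intro summable_reindex) (auto intro: injI)
  then have "summable (\<lambda>m. C (2 * m + 1) / real (double_fact (2 * m + 1)) * \<epsilon>\<^sub>2 ^ (2 * m + 1))"
    by (simp add: o_def del: double_fact.simps)
  \<comment> \<open>The factor \<open>1 / \<epsilon>\<^sub>2\<close> lowers the exponent from 2m+1
    to 2m.\<close>
  then have "summable (\<lambda>m. C (2 * m + 1) / real (double_fact (2 * m + 1)) * \<epsilon>\<^sub>2 ^ (2 * m + 1) * (1 / \<epsilon>\<^sub>2))"
    by (rule summable_mult2)
  then have "summable (\<lambda>m. D m * q ^ (2 * m))"
  proof (rule summable_comparison_test'[where N = 0])
    fix m :: nat
    have "real (double_fact (2 * m + 1)) \<le> real (4 ^ m * double_fact (2 * m))"
      by (intro of_nat_mono odd_double_fact_le)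
    then have "1 / (real (double_fact (2 * m)) * 4 ^ m) \<le> 1 / real (double_fact (2 * m + 1))"
      using double_fact_pos[of "2 * m + 1"] double_fact_pos[of "2 * m"]
      by (intro divide_left_mono) (auto simp: mult.commute simp del: double_fact.simps)
    then have "C (2 * m + 1) * \<epsilon>\<^sub>2 ^ (2 * m) * (1 / (real (double_fact (2 * m)) * 4 ^ m)) \<le>
        C (2 * m + 1) * \<epsilon>\<^sub>2 ^ (2 * m) * (1 / real (double_fact (2 * m + 1)))"
      using pos(1) pos(2)[of "2 * m + 1"] by (intro mult_left_mono) auto
    moreover have "D m * q ^ (2 * m) = C (2 * m + 1) * \<epsilon>\<^sub>2 ^ (2 * m) * (1 / (real (double_fact (2 * m)) * 4 ^ m))"
      by (simp add: D_def q_def power_divide power_mult)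
    moreover have "C (2 * m + 1) * \<epsilon>\<^sub>2 ^ (2 * m) * (1 / real (double_fact (2 * m + 1))) =
        C (2 * m + 1) / real (double_fact (2 * m + 1)) * \<epsilon>\<^sub>2 ^ (2 * m + 1) * (1 / \<epsilon>\<^sub>2)"
      using pos(1) by (simp del: double_fact.simps)
    moreover have "norm (D m * q ^ (2 * m)) = D m * q ^ (2 * m)"
      using D0[of m] q by simp
    ultimately show "norm (D m * q ^ (2 * m)) \<le>
        C (2 * m + 1) / real (double_fact (2 * m + 1)) * \<epsilon>\<^sub>2 ^ (2 * m + 1) * (1 / \<epsilon>\<^sub>2)"
      by linarith
  qed
  then have "summable (\<lambda>k. D (k + (M + 1)) * q ^ (2 * (k + (M + 1))))"
    by (rule summable_ignore_initial_segment)
  \<comment> \<open>Dividing out the power of \<open>q\<close> belonging to the first omitted term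
    leaves \<open>q ^ (2 * k)\<close>.\<close>
  then have "summable (\<lambda>k. D (k + (M + 1)) * q ^ (2 * (k + (M + 1))) * (1 / q ^ (2 * (M + 1))))"
    by (rule summable_mult2)
  moreover have "D (k + (M + 1)) * q ^ (2 * (k + (M + 1))) * (1 / q ^ (2 * (M + 1))) = D (k + (M + 1)) * q ^ (2 * k)" for k
  proof -
    have "q ^ (2 * (k + (M + 1))) = q ^ (2 * k) * q ^ (2 * (M + 1))"
      by (simp only: add_mult_distrib2 power_add)
    then show ?thesis using q by simp
  qed
  ultimately have tail: "summable (\<lambda>k. D (k + (M + 1)) * q ^ (2 * k))" by simp
  show ?thesis
  proof (rule bigoI)
    have "\<forall>\<^sub>F \<epsilon> in at_right 0. \<epsilon> \<in> {0<..<q}"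
      using q by (intro eventually_at_right_real)
    with sums show "\<forall>\<^sub>F \<epsilon> in at_right 0. norm (S \<epsilon> - (\<Sum>m\<le>M. Theta_term m (\<mu> \<epsilon>) x)) \<le>
        (\<Sum>k. D (k + (M + 1)) * q ^ (2 * k)) * norm (\<epsilon> ^ (2 * (M + 1)))"
    proof eventually_elim
      case (elim \<epsilon>)
      then have e: "0 < \<epsilon>" "\<epsilon> \<le> q" by auto
      let ?T = "\<lambda>m. Theta_term m (\<mu> \<epsilon>) x"
      have "(\<lambda>k. ?T (k + (M + 1))) sums (S \<epsilon> - (\<Sum>m<M + 1. ?T m))"
        using elim(1) sums_iff_shift[of ?T "M + 1" "S \<epsilon> - (\<Sum>m<M + 1. ?T m)"]
        by (simp del: sum.lessThan_Suc)
      then have "S \<epsilon> - (\<Sum>m\<le>M. ?T m) = (\<Sum>k. ?T (k + (M + 1)))"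
        by (simp add: sums_iff lessThan_Suc_atMost)
      moreover have "norm (\<Sum>k. ?T (k + (M + 1))) \<le> (\<Sum>k. D (k + (M + 1)) * q ^ (2 * k) * \<epsilon> ^ (2 * (M + 1)))"
      proof (rule norm_suminf_le)
        fix k
        let ?m = "k + (M + 1)"
        have "\<bar>?T ?m\<bar> \<le> \<bar>theta_hat_deriv (2 * ?m + 1) (\<mu> \<epsilon>) x\<bar> / real (double_fact (2 * ?m))"
          by (rule abs_Theta_term_le)
        also have "\<dots> \<le> C (2 * ?m + 1) * \<epsilon> ^ (2 * ?m + 1 - 1) / real (double_fact (2 * ?m))"
          using e q by (intro divide_right_mono bound) auto
        also have "\<dots> = D ?m * \<epsilon> ^ (2 * k) * \<epsilon> ^ (2 * (M + 1))"
        proof -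
          have "\<epsilon> ^ (2 * ?m + 1 - 1) = \<epsilon> ^ (2 * k) * \<epsilon> ^ (2 * (M + 1))"
            by (simp only: add_mult_distrib2 power_add add_diff_cancel_right')
          then show ?thesis unfolding D_def by simp
        qed
        also have "\<dots> \<le> D ?m * q ^ (2 * k) * \<epsilon> ^ (2 * (M + 1))"
          using e D0 by (intro mult_right_mono mult_left_mono power_mono) auto
        finally show "norm (?T ?m) \<le> D ?m * q ^ (2 * k) * \<epsilon> ^ (2 * (M + 1))" by simp
      qed (intro summable_mult2 tail)
      moreover have "(\<Sum>k. D (k + (M + 1)) * q ^ (2 * k) * \<epsilon> ^ (2 * (M + 1))) =
          (\<Sum>k. D (k + (M + 1)) * q ^ (2 * k)) * \<epsilon> ^ (2 * (M + 1))"
        using tail by (rule suminf_mult2[symmetric])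
      ultimately show ?case using e by simp
    qed
  qed
qed

section \<open>Uniform cumulant bounds at the saddlepoint and the resulting orders\<close>

text \<open>An upper limit below infinity lies below some natural number, and eventually so does the
  supremum. The supremum is taken in \<open>ereal\<close>, where it is meaningful without a
  boundedness assumption.\<close>

lemma eventually_le_of_Limsup_SUP_finite:
  fixes g :: "'b \<Rightarrow> 'a \<Rightarrow> real"
  assumes "Limsup F (\<lambda>\<epsilon>. SUP t\<in>C. ereal (g \<epsilon> t)) < \<infinity>"
  shows "\<exists>B. \<forall>\<^sub>F \<epsilon> in F. \<forall>t\<in>C. g \<epsilon> t \<le> B"
proof -
  have "Limsup F (\<lambda>\<epsilon>. SUP t\<in>C. ereal (g \<epsilon> t)) \<noteq> \<infinity>"
    using assms by simp
  from iffD1[OF less_PInf_Ex_of_nat this]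
  obtain n where "Limsup F (\<lambda>\<epsilon>. SUP t\<in>C. ereal (g \<epsilon> t)) < ereal (real n)"
    by (elim exE)
  then have "\<forall>\<^sub>F \<epsilon> in F. (SUP t\<in>C. ereal (g \<epsilon> t)) < ereal (real n)"
    by (rule Limsup_lessD)
  then have "\<forall>\<^sub>F \<epsilon> in F. \<forall>t\<in>C. g \<epsilon> t \<le> real n"
  proof eventually_elim
    case (elim \<epsilon>)
    show ?case
    proof
      fix t assume "t \<in> C"
      then have "ereal (g \<epsilon> t) \<le> (SUP t\<in>C. ereal (g \<epsilon> t))" by (rule SUP_upper)
      from this elim have "ereal (g \<epsilon> t) < ereal (real n)" by (rule le_less_trans)
      then show "g \<epsilon> t \<le> real n" by simp
    qed
  qed
  then show ?thesis by blast
qed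

lemma eventually_abs_le_of_uniform_limit:
  fixes f :: "'b \<Rightarrow> 'a \<Rightarrow> real"
  assumes "uniform_limit {t} f l F"
  shows "\<forall>\<^sub>F \<epsilon> in F. \<bar>f \<epsilon> t\<bar> \<le> \<bar>l t\<bar> + 1"
proof -
  have "((\<lambda>\<epsilon>. f \<epsilon> t) \<longlongrightarrow> l t) F"
    using assms by (rule tendsto_uniform_limitI) simp
  then have "((\<lambda>\<epsilon>. \<bar>f \<epsilon> t\<bar>) \<longlongrightarrow> \<bar>l t\<bar>) F" by (rule tendsto_rabs)
  then have "\<forall>\<^sub>F \<epsilon> in F. \<bar>f \<epsilon> t\<bar> < \<bar>l t\<bar> + 1" by (rule order_tendstoD) simp
  then show ?thesis by (rule eventually_mono) simp
qed

text \<open>Convergence at the point 0 controls K'(0), hence the saddlepoint, and K''(0). Together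
  with the bounds on a compact interval this gives the order of every cumulant at the saddlepoint,
  which power series inversion carries over to \<theta>.\<close>

lemma theta_hat_deriv_bigo:
  fixes \<mu> :: "real \<Rightarrow> real measure"
  assumes convex: "\<And>\<epsilon>. \<epsilon> \<in> {0..1} \<Longrightarrow> strongly_convex_cgf (\<mu> \<epsilon>) d"
    and zero: "\<And>\<epsilon>. \<epsilon> \<in> {0..1} \<Longrightarrow> 0 \<in> interior (cgf_domain (\<mu> \<epsilon>))"
    and limit: "\<And>r. uniform_limit {0} (\<lambda>\<epsilon>. (deriv ^^ r) (cgf (\<mu> \<epsilon>))) (l r) (at_right 0)"
    and bound: "\<And>r C. r \<ge> 3 \<Longrightarrow> compact C \<Longrightarrow>
               Limsup (at_right 0)
                 (\<lambda>\<epsilon>. SUP \<theta>\<in>C. ereal (\<bar>(deriv ^^ r) (cgf (\<mu> \<epsilon>)) \<theta>\<bar> / \<epsilon> ^ (r - 2))) < \<infinity>"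
    and n: "1 \<le> n"
  shows "(\<lambda>\<epsilon>. theta_hat_deriv n (\<mu> \<epsilon>) x) \<in> O[at_right 0](\<lambda>\<epsilon>. \<epsilon> ^ (n - 1))"
proof -
  let ?K = "\<lambda>r \<epsilon>. (deriv ^^ r) (cgf (\<mu> \<epsilon>))"
  let ?s = "\<lambda>\<epsilon>. saddlepoint (\<mu> \<epsilon>) x"
  have d: "0 < d" using convex[of 0] by (simp add: strongly_convex_cgf.d_pos)
  have small: "\<forall>\<^sub>F \<epsilon> in at_right 0. \<epsilon> \<in> {0<..<1::real}"
    by (intro eventually_at_right_real) simp
  \<comment> \<open>The bound of \<open>saddlepoint_bound\<close>, with K'(0) eventually within 1 of
    its limit in absolute value.\<close>
  define R where "R = (\<bar>x\<bar> + (\<bar>l 1 0\<bar> + 1)) / d"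
  have sR: "\<forall>\<^sub>F \<epsilon> in at_right 0. \<bar>?s \<epsilon>\<bar> \<le> R"
    using small eventually_abs_le_of_uniform_limit[OF limit[of 1]]
  proof eventually_elim
    case (elim \<epsilon>)
    interpret strongly_convex_cgf "\<mu> \<epsilon>" d using elim by (intro convex) auto
    have "\<bar>?s \<epsilon>\<bar> \<le> \<bar>x - deriv (cgf (\<mu> \<epsilon>)) 0\<bar> / d"
      using elim by (intro saddlepoint_bound zero) auto
    also have "\<dots> \<le> R"
      unfolding R_def using elim d by (intro divide_right_mono) auto
    finally show ?case .
  qed
  have high: "\<exists>B. \<forall>\<^sub>F \<epsilon> in at_right 0. \<forall>t\<in>{-R..R}. \<bar>?K r \<epsilon> t\<bar> \<le> B * \<epsilon> ^ (r - 2)" if r: "3 \<le> r" for r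
  proof -
    obtain B where "\<forall>\<^sub>F \<epsilon> in at_right 0. \<forall>t\<in>{-R..R}. \<bar>?K r \<epsilon> t\<bar> / \<epsilon> ^ (r - 2) \<le> B"
      using eventually_le_of_Limsup_SUP_finite[OF bound[OF r, of "{-R..R}"]] by auto
    with small have "\<forall>\<^sub>F \<epsilon> in at_right 0. \<forall>t\<in>{-R..R}. \<bar>?K r \<epsilon> t\<bar> \<le> B * \<epsilon> ^ (r - 2)"
      by eventually_elim (auto simp: field_simps)
    then show ?thesis by blast
  qed
  have K_saddle: "\<exists>B. \<forall>\<^sub>F \<epsilon> in at_right 0. \<bar>?K r \<epsilon> (?s \<epsilon>)\<bar> \<le> B * \<epsilon> ^ (r - 2)" if r: "2 \<le> r" for r
  proof (cases "r = 2")
    case False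
    with r obtain B where "\<forall>\<^sub>F \<epsilon> in at_right 0. \<forall>t\<in>{-R..R}. \<bar>?K r \<epsilon> t\<bar> \<le> B * \<epsilon> ^ (r - 2)"
      using high[of r] by auto
    with sR have "\<forall>\<^sub>F \<epsilon> in at_right 0. \<bar>?K r \<epsilon> (?s \<epsilon>)\<bar> \<le> B * \<epsilon> ^ (r - 2)"
      by eventually_elim (auto simp: abs_le_iff)
    then show ?thesis by blast
  next
    case True
    obtain B where B: "\<forall>\<^sub>F \<epsilon> in at_right 0. \<forall>t\<in>{-R..R}. \<bar>?K 3 \<epsilon> t\<bar> \<le> B * \<epsilon> ^ (3 - 2)"
      using high[of 3] by auto
    have "\<forall>\<^sub>F \<epsilon> in at_right 0. \<bar>?K 2 \<epsilon> (?s \<epsilon>)\<bar> \<le> \<bar>l 2 0\<bar> + 1 + \<bar>B\<bar> * R"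
      using small sR B eventually_abs_le_of_uniform_limit[OF limit[of 2]]
    proof eventually_elim
      case (elim \<epsilon>)
      interpret strongly_convex_cgf "\<mu> \<epsilon>" d using elim(1) by (intro convex) auto
      \<comment> \<open>A convex set containing 0 and the saddlepoint, on which K'' is
        differentiable and the bound on the third derivative is valid. For r = 2 the target exponent
        is 0, so comparison with K''(0) suffices.\<close>
      let ?D = "interior (cgf_domain (\<mu> \<epsilon>)) \<inter> {-R..R}"
      have "convex ?D"
        by (rule convex_Int[OF convex_interior[OF convex_cgf_domain] convex_real_interval(5)])
      moreover have "(?K 2 \<epsilon> has_field_derivative ?K 3 \<epsilon> t) (at t within ?D)" if "t \<in> ?D" for t
        using DERIV_cgf_higher_deriv[of t 2] that has_field_derivative_at_within
        by (simp add: eval_nat_numeral)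
      moreover have "norm (?K 3 \<epsilon> t) \<le> \<bar>B\<bar>" if "t \<in> ?D" for t
      proof -
        have "\<bar>?K 3 \<epsilon> t\<bar> \<le> B * \<epsilon>" using elim(3) that by simp
        also have "\<dots> \<le> \<bar>B\<bar> * 1" using elim(1) by (intro mult_mono) auto
        finally show ?thesis by simp
      qed
      moreover have "?s \<epsilon> \<in> ?D" using elim(2) saddlepoint_interior by (auto simp: abs_le_iff)
      moreover have "0 \<le> R" using elim(2) by linarith
      then have "0 \<in> ?D" using zero[of \<epsilon>] elim(1) by auto
      ultimately have "norm (?K 2 \<epsilon> (?s \<epsilon>) - ?K 2 \<epsilon> 0) \<le> \<bar>B\<bar> * norm (?s \<epsilon> - 0)"
        by (rule field_differentiable_bound)
      also have "\<dots> \<le> \<bar>B\<bar> * R" using elim(2) by (intro mult_left_mono) auto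
      finally show ?case using elim(4) by simp
    qed
    then show ?thesis using True by auto
  qed
  have "(\<lambda>\<epsilon>. fps_nth (saddle_inverse_fps (\<mu> \<epsilon>) x) n) \<in> O[at_right 0](\<lambda>\<epsilon>. of_real \<epsilon> ^ (n - 1))"
  \<comment> \<open>The bound is \<open>d / 2\<close> because the second Taylor coefficient is half
    the second derivative.\<close>
  proof (rule inverse_fps_nth_bigo[where A = "\<lambda>\<epsilon>. saddle_cgf_fps (\<mu> \<epsilon>) x" and d = "d / 2"])
    show "\<forall>\<^sub>F \<epsilon> in at_right 0. saddle_cgf_fps (\<mu> \<epsilon>) x oo saddle_inverse_fps (\<mu> \<epsilon>) x =
        fps_const (1/2) * fps_X ^ 2"
      using small
    proof eventually_elim
      case (elim \<epsilon>)
      interpret strongly_convex_cgf "\<mu> \<epsilon>" d using elim by (intro convex) auto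
      show ?case by (rule saddle_fps_compose)
    qed
    show "\<forall>\<^sub>F \<epsilon> in at_right 0. d / 2 \<le> norm (fps_nth (saddle_cgf_fps (\<mu> \<epsilon>) x) 2)"
      using small
    proof eventually_elim
      case (elim \<epsilon>)
      interpret strongly_convex_cgf "\<mu> \<epsilon>" d using elim by (intro convex) auto
      have "d \<le> ?K 2 \<epsilon> (?s \<epsilon>)" by (intro cgf_deriv2_ge saddlepoint_interior)
      then show ?case using d by (simp add: saddle_cgf_fps_def norm_divide)
    qed
    fix r :: nat assume r: "2 \<le> r"
    obtain B where B: "\<forall>\<^sub>F \<epsilon> in at_right 0. \<bar>?K r \<epsilon> (?s \<epsilon>)\<bar> \<le> B * \<epsilon> ^ (r - 2)"
      using K_saddle[OF r] by blast
    show "(\<lambda>\<epsilon>. fps_nth (saddle_cgf_fps (\<mu> \<epsilon>) x) r) \<in> O[at_right 0](\<lambda>\<epsilon>. of_real \<epsilon> ^ (r - 2))"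
    proof (rule bigoI)
      show "\<forall>\<^sub>F \<epsilon> in at_right 0. norm (fps_nth (saddle_cgf_fps (\<mu> \<epsilon>) x) r) \<le>
          B * norm (complex_of_real \<epsilon> ^ (r - 2))"
        using small B
      proof eventually_elim
        case (elim \<epsilon>)
        have "norm (fps_nth (saddle_cgf_fps (\<mu> \<epsilon>) x) r) = \<bar>?K r \<epsilon> (?s \<epsilon>)\<bar> / fact r"
          using r by (simp add: saddle_cgf_fps_def norm_divide)
        also have "\<dots> \<le> \<bar>?K r \<epsilon> (?s \<epsilon>)\<bar> / 1"
          by (intro divide_left_mono) auto
        finally show ?case using elim by (simp add: norm_power)
      qed
    qed
  qed (use d n in \<open>auto simp: saddle_cgf_fps_def saddle_inverse_fps_def\<close>)
  then obtain B where B: "\<forall>\<^sub>F \<epsilon> in at_right 0.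
      norm (fps_nth (saddle_inverse_fps (\<mu> \<epsilon>) x) n) \<le> B * norm (complex_of_real \<epsilon> ^ (n - 1))"
    by (auto elim: landau_o.bigE)
  show ?thesis
  proof (rule bigoI)
    show "\<forall>\<^sub>F \<epsilon> in at_right 0. norm (theta_hat_deriv n (\<mu> \<epsilon>) x) \<le> (fact n * B) * norm (\<epsilon> ^ (n - 1))"
      using B
    proof eventually_elim
      case (elim \<epsilon>)
      then show ?case using n
        by (simp add: saddle_inverse_fps_def norm_divide norm_power power_abs field_simps)
    qed
  qed
qed

section \<open>Orders of the terms and of the remainder in the saddlepoint expansion\<close>

theorem theorem5:
  fixes \<mu> :: "real \<Rightarrow> real measure" and x :: real
  assumes prob: "\<And>\<epsilon>. \<epsilon> \<in> {0..1} \<Longrightarrow> real_distribution (\<mu> \<epsilon>)"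
    and onto: "\<And>\<epsilon>. \<epsilon> \<in> {0..1} \<Longrightarrow> deriv (cgf (\<mu> \<epsilon>)) ` interior (cgf_domain (\<mu> \<epsilon>)) = UNIV"
    and A1: "\<And>\<epsilon>. \<epsilon> \<in> {0..1} \<Longrightarrow> \<exists>a b. 0 \<in> {a<..<b} \<and> {a<..<b} \<subseteq> cgf_domain (\<mu> \<epsilon>)"
    and A2_support: "\<And>\<epsilon>. \<epsilon> \<in> {0..1} \<Longrightarrow> measure_support (\<mu> \<epsilon>) = UNIV"
    and A2_char: "\<And>\<epsilon>. \<epsilon> \<in> {0..1} \<Longrightarrow> integrable lborel (char (\<mu> \<epsilon>))"
    and A3: "\<exists>\<delta>\<^sub>0>0. \<forall>\<epsilon>\<in>{0..1}. \<forall>\<theta>\<in>interior (cgf_domain (\<mu> \<epsilon>)).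
               (deriv ^^ 2) (cgf (\<mu> \<epsilon>)) \<theta> \<ge> \<delta>\<^sub>0"
    and A4: "\<exists>I :: real \<Rightarrow> real set.
               (\<forall>\<epsilon>\<in>{0<..1}. is_interval (I \<epsilon>) \<and> I \<epsilon> \<subseteq> cgf_domain (\<mu> \<epsilon>)) \<and>
               (\<forall>\<epsilon>\<in>{0<..1}. \<forall>\<epsilon>'\<in>{0<..1}. \<epsilon> \<ge> \<epsilon>' \<longrightarrow> I \<epsilon> \<subseteq> I \<epsilon>') \<and>
               (\<Union>\<epsilon>\<in>{0<..1}. I \<epsilon>) = UNIV"
    and A5_limit: "\<And>r C. compact C \<Longrightarrow>
               uniform_limit C (\<lambda>\<epsilon>. (deriv ^^ r) (cgf (\<mu> \<epsilon>))) ((deriv ^^ r) (cgf (\<mu> 0))) (at_right 0)"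
    and A5_bound: "\<And>r C. r \<ge> 3 \<Longrightarrow> compact C \<Longrightarrow>
               Limsup (at_right 0)
                 (\<lambda>\<epsilon>. SUP \<theta>\<in>C. ereal (\<bar>(deriv ^^ r) (cgf (\<mu> \<epsilon>)) \<theta>\<bar> / \<epsilon> ^ (r - 2))) < \<infinity>"
    and expansion: "\<forall>\<^sub>F \<epsilon> in at_right 0.
               (\<lambda>m. Theta_term m (\<mu> \<epsilon>) x) sums continuous_density (\<mu> \<epsilon>) x"
  shows "(\<forall>m. (\<lambda>\<epsilon>. Theta_term m (\<mu> \<epsilon>) x) \<in> O[at_right 0](\<lambda>\<epsilon>. \<epsilon> ^ (2 * m))) \<and>
    ((\<exists>\<epsilon>\<^sub>2\<in>{0<..1}. \<exists>C :: nat \<Rightarrow> real.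
        (\<forall>n\<ge>1. C n > 0) \<and>
        (\<forall>n\<ge>1. \<forall>\<epsilon>. 0 < \<epsilon> \<and> \<epsilon> \<le> \<epsilon>\<^sub>2 \<longrightarrow>
           \<bar>theta_hat_deriv n (\<mu> \<epsilon>) x\<bar> \<le> C n * \<epsilon> ^ (n - 1)) \<and>
        summable (\<lambda>n. C (Suc n) / real (double_fact (Suc n)) * \<epsilon>\<^sub>2 ^ Suc n)) \<longrightarrow>
     (\<forall>M. (\<lambda>\<epsilon>. continuous_density (\<mu> \<epsilon>) x - (\<Sum>m\<le>M. Theta_term m (\<mu> \<epsilon>) x))
             \<in> O[at_right 0](\<lambda>\<epsilon>. \<epsilon> ^ (2 * (M + 1)))))"
proof (intro conjI allI impI)
  fix m
  obtain d where d: "0 < d" "\<And>\<epsilon> t. \<epsilon> \<in> {0..1} \<Longrightarrow> t \<in> interior (cgf_domain (\<mu> \<epsilon>)) \<Longrightarrow>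
      d \<le> (deriv ^^ 2) (cgf (\<mu> \<epsilon>)) t"
    using A3 by blast
  have "(\<lambda>\<epsilon>. theta_hat_deriv (2 * m + 1) (\<mu> \<epsilon>) x) \<in> O[at_right 0](\<lambda>\<epsilon>. \<epsilon> ^ (2 * m + 1 - 1))"
  \<comment> \<open>The limits are the derivatives for \<epsilon> = 0, with (A5) taken on the
    compact set {0}; (A1) makes 0 an interior point of each domain.\<close>
  proof (rule theta_hat_deriv_bigo[where d = d and l = "\<lambda>r. (deriv ^^ r) (cgf (\<mu> 0))"])
    fix \<epsilon> :: real assume e: "\<epsilon> \<in> {0..1}"
    show "strongly_convex_cgf (\<mu> \<epsilon>) d"
      by (intro strongly_convex_cgf.intro strongly_convex_cgf_axioms.intro prob onto d e)
    obtain a b where "0 \<in> {a<..<b}" "{a<..<b} \<subseteq> cgf_domain (\<mu> \<epsilon>)"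
      using A1[OF e] by (elim exE conjE)
    then show "0 \<in> interior (cgf_domain (\<mu> \<epsilon>))"
      by (intro interiorI[of "{a<..<b}"]) simp_all
  qed (rule A5_limit A5_bound | simp)+
  then have "(\<lambda>\<epsilon>. theta_hat_deriv (2 * m + 1) (\<mu> \<epsilon>) x / real (double_fact (2 * m)))
      \<in> O[at_right 0](\<lambda>\<epsilon>. \<epsilon> ^ (2 * m))"
    using double_fact_pos[of "2 * m"] by simp
  moreover have "(\<lambda>\<epsilon>. Theta_term m (\<mu> \<epsilon>) x)
      \<in> O[at_right 0](\<lambda>\<epsilon>. theta_hat_deriv (2 * m + 1) (\<mu> \<epsilon>) x / real (double_fact (2 * m)))"
    by (rule bigoI[where c = 1], rule always_eventually) (use abs_Theta_term_le in simp)
  ultimately show "(\<lambda>\<epsilon>. Theta_term m (\<mu> \<epsilon>) x) \<in> O[at_right 0](\<lambda>\<epsilon>. \<epsilon> ^ (2 * m))"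
    by (rule landau_o.big_trans[rotated])
next
  fix M
  assume "\<exists>\<epsilon>\<^sub>2\<in>{0<..1}. \<exists>C :: nat \<Rightarrow> real.
        (\<forall>n\<ge>1. C n > 0) \<and>
        (\<forall>n\<ge>1. \<forall>\<epsilon>. 0 < \<epsilon> \<and> \<epsilon> \<le> \<epsilon>\<^sub>2 \<longrightarrow>
           \<bar>theta_hat_deriv n (\<mu> \<epsilon>) x\<bar> \<le> C n * \<epsilon> ^ (n - 1)) \<and>
        summable (\<lambda>n. C (Suc n) / real (double_fact (Suc n)) * \<epsilon>\<^sub>2 ^ Suc n)"
  then obtain \<epsilon>\<^sub>2 and C :: "nat \<Rightarrow> real" where e2: "\<epsilon>\<^sub>2 \<in> {0<..1}"
    and C: "(\<forall>n\<ge>1. C n > 0) \<and> (\<forall>n\<ge>1. \<forall>\<epsilon>. 0 < \<epsilon> \<and> \<epsilon> \<le> \<epsilon>\<^sub>2 \<longrightarrow>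
           \<bar>theta_hat_deriv n (\<mu> \<epsilon>) x\<bar> \<le> C n * \<epsilon> ^ (n - 1)) \<and>
        summable (\<lambda>n. C (Suc n) / real (double_fact (Suc n)) * \<epsilon>\<^sub>2 ^ Suc n)"
    by (elim bexE exE)
  show "(\<lambda>\<epsilon>. continuous_density (\<mu> \<epsilon>) x - (\<Sum>m\<le>M. Theta_term m (\<mu> \<epsilon>) x))
      \<in> O[at_right 0](\<lambda>\<epsilon>. \<epsilon> ^ (2 * (M + 1)))"
  \<comment> \<open>The sum \<open>S\<close> of the series becomes the density at \<open>x\<close>,
    and (A8) supplies the dominating series.\<close>
  proof (rule Theta_term_tail_bigo[OF expansion])
    show "0 < \<epsilon>\<^sub>2" using e2 by simp
    show "summable (\<lambda>n. C (Suc n) / real (double_fact (Suc n)) * \<epsilon>\<^sub>2 ^ Suc n)"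
      using C by (elim conjE)
    show "0 < C n" if "1 \<le> n" for n using C[THEN conjunct1] that by blast
    show "\<bar>theta_hat_deriv n (\<mu> \<epsilon>) x\<bar> \<le> C n * \<epsilon> ^ (n - 1)"
      if "1 \<le> n" "0 < \<epsilon>" "\<epsilon> \<le> \<epsilon>\<^sub>2" for n \<epsilon>
      using C[THEN conjunct2, THEN conjunct1] that by blast
  qed
qed

end
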